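(* Let $p$ be a prime and let $k,n$ be natural numbers with $k+1\le p$ and $n+2\le p$. Fix an abelian group $(A,+)$ of cardinality $p^n$. Then the map sending a nilpotent pre-Lie ring $(A,+,\cdot)$ of nilpotency index $k$ to its group-of-flows brace $(A,+,\circ)$ is a bijection from the set of nilpotent pre-Lie ring structures on $(A,+)$ of nilpotency index $k$ onto the set of strongly nilpotent (left) brace structures on $(A,+)$ of nilpotency index $k$. Its inverse sends a strongly nilpotent brace $(A,+,\circ)$ to its associated pre-Lie ring $(A,+,\odot)$. In particular there is a one-to-one correspondence between strongly nilpotent braces of cardinality $p^n$ and nilpotency index $k$ and nilpotent pre-Lie rings of cardinality $p^n$ and nilpotency index $k$.
   Context: A (left) brace is a set $A$ with binary operations $+,\circ$ such that $(A,+)$ is an abelian group, $(A,\circ)$ is a group, and $a\circ(b+c)+a=a\circ b+a\circ c$ for all $a,b,c$. Write $a*b=a\circ b-a-b$. For additive subgroups $X,Y$, $X*Y$ is the additive subgroup generated by all $x*y$ ($x\in X,y\in Y$). Set $A^{1}=A^{(1)}=A^{[1]}=A$, $A^{i+1}=A*A^{i}$, $A^{(i+1)}=A^{(i)}*A$, $A^{[i+1]}=\sum_{j=1}^{i}A^{[j]}*A^{[i+1-j]}$. A brace is left nilpotent if $A^m=0$ for some $m$, right nilpotent if $A^{(m)}=0$ for some $m$, strongly nilpotent if $A^{[m]}=0$ for some $m$; it has nilpotency index $k$ if $A^{[k]}=0\ne A^{[k-1]}$. For an integer $m$, $ma$ is the $m$-fold additive multiple. A pre-Lie ring is an abelian group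 $(A,+)$ with a biadditive product $\cdot$ satisfying $(x\cdot y)\cdot z-x\cdot(y\cdot z)=(y\cdot x)\cdot z-y\cdot(x\cdot z)$. The series $A^i$, $A^{(i)}$, $A^{[i]}$ and the notions left nilpotent, right nilpotent, nilpotent (=strongly nilpotent: $A^{[m]}=0$ for some $m$, equivalently all products of $m$ elements with any bracketing vanish) and nilpotency index $k$ ($A^{[k]}=0\neq A^{[k-1]}$) are defined as for braces with $\cdot$ in place of $*$. Group of flows: let $(A,+,\cdot)$ be a left nilpotent pre-Lie ring of cardinality $p^n$ with $p>n+1$ prime. Let $A^{\mathrm{id}}=A\times\mathbb Z$ with $(r,m)+(s,m')=(r+s,m+m')$, $(r,m)\cdot(s,m')=(r\cdot s+ms+m'r,mm')$; identify $A$ with $A\times\{0\}$, put $1=(0,1)$. For $a\in A$ let $L_a(x)=a\cdot x$ and $e^{L_a}(x)=\sum_{j\ge 0}\frac{1}{j!}L_a^j(x)$ for $x\in A^{\mathrm{id}}$ (finite sum since $A^{n+1}=0$; the needed factorials are invertible modulo $p^n$). Let $W(a)=e^{L_a}(1)-1\in A$; $W:A\to A$ is a bijection, with inverse $\Omega$. The group of flows is $(A,\circ)$ with $a\circ b=a+e^{L_{\Omega(a)}}(b)$, and $(A,+,\circ)$ is the group-of-flows brace. Associated pre-Lie ring: let $\gamma$ be a primitive root modulo $p^p$ and $\xi=\gamma^{p^{p-1}}$. For a brace $(A,+,\circ)$ of cardinality $p^n$ define $a\cdot b=\sum_{i=0}^{p-2}\xi^{p-1-i}((\xi^i a)*b)$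 and $a\odot b=-(1+p+p^2+\dots+p^{n-1})(a\cdot b)$; $(A,+,\odot)$ is the pre-Lie ring associated to the brace. *)

theory Defs
  imports Main "HOL-Number_Theory.Number_Theory"
begin

fun natmul :: "nat \<Rightarrow> 'a::ab_group_add \<Rightarrow> 'a" where
  "natmul 0 a = 0"
| "natmul (Suc m) a = a + natmul m a"

definition zmul :: "int \<Rightarrow> 'a::ab_group_add \<Rightarrow> 'a" where
  "zmul m a = (if m \<ge> 0 then natmul (nat m) a else - natmul (nat (- m)) a)"

inductive_set addgen :: "'a::ab_group_add set \<Rightarrow> 'a set" for S where
  zero: "0 \<in> addgen S"
| base: "s \<in> S \<Longrightarrow> s \<in> addgen S"
| diff: "a \<in> addgen S \<Longrightarrow> b \<in> addgen S \<Longrightarrow> a - b \<in> addgen S"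

definition subprod :: "('a::ab_group_add \<Rightarrow> 'a \<Rightarrow> 'a) \<Rightarrow> 'a set \<Rightarrow> 'a set \<Rightarrow> 'a set" where
  "subprod op X Y = addgen {op x y | x y. x \<in> X \<and> y \<in> Y}"

definition subsum :: "nat set \<Rightarrow> (nat \<Rightarrow> 'a::ab_group_add set) \<Rightarrow> 'a set" where
  "subsum J F = addgen (\<Union>j\<in>J. F j)"

lemma subsum_cong [fundef_cong]:
  "J = J' \<Longrightarrow> (\<And>j. j \<in> J' \<Longrightarrow> F j = G j) \<Longrightarrow> subsum J F = subsum J' G"
  unfolding subsum_def by simp

text \<open>Strong series: strong_series op i = A^[i] for i \<ge> 1; A^[1] = A,
  A^[i+1] = sum_{j=1..i} A^[j] * A^[i+1-j]. (Index 0 is set to A as well.)\<close>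
function strong_series :: "('a::ab_group_add \<Rightarrow> 'a \<Rightarrow> 'a) \<Rightarrow> nat \<Rightarrow> 'a set" where
  "strong_series op i =
     (if i \<le> 1 then UNIV
      else subsum {1..i - 1} (\<lambda>j. subprod op (strong_series op j) (strong_series op (i - j))))"
  by auto
termination
proof (relation "measure snd")
  show "wf (measure snd)" by simp
qed (auto simp: subsum_def intro!: image_cong)

definition nilpotency_index :: "('a::ab_group_add \<Rightarrow> 'a \<Rightarrow> 'a) \<Rightarrow> nat \<Rightarrow> bool" where
  "nilpotency_index op k \<longleftrightarrow> strong_series op k = {0} \<and> strong_series op (k - 1) \<noteq> {0}"

definition is_prelie :: "('a::ab_group_add \<Rightarrow> 'a \<Rightarrow> 'a) \<Rightarrow> bool" where
  "is_prelie m \<longleftrightarrow>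
     (\<forall>x y z. m (x + y) z = m x z + m y z) \<and>
     (\<forall>x y z. m x (y + z) = m x y + m x z) \<and>
     (\<forall>x y z. m (m x y) z - m x (m y z) = m (m y x) z - m y (m x z))"

definition is_group_op :: "('a \<Rightarrow> 'a \<Rightarrow> 'a) \<Rightarrow> bool" where
  "is_group_op c \<longleftrightarrow>
     (\<forall>a b d. c (c a b) d = c a (c b d)) \<and>
     (\<exists>e. (\<forall>a. c e a = a \<and> c a e = a) \<and> (\<forall>a. \<exists>b. c a b = e \<and> c b a = e))"

definition is_brace :: "('a::ab_group_add \<Rightarrow> 'a \<Rightarrow> 'a) \<Rightarrow> bool" where
  "is_brace c \<longleftrightarrow> is_group_op c \<and> (\<forall>a b d. c a (b + d) + a = c a b + c a d)"

definition brace_star :: "('a::ab_group_add \<Rightarrow> 'a \<Rightarrow> 'a) \<Rightarrow> 'a \<Rightarrow> 'a \<Rightarrow> 'a" where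
  "brace_star c a b = c a b - a - b"

definition prelie_structures :: "nat \<Rightarrow> ('a::ab_group_add \<Rightarrow> 'a \<Rightarrow> 'a) set" where
  "prelie_structures k = {m. is_prelie m \<and> nilpotency_index m k}"

definition brace_structures :: "nat \<Rightarrow> ('a::ab_group_add \<Rightarrow> 'a \<Rightarrow> 'a) set" where
  "brace_structures k = {c. is_brace c \<and> nilpotency_index (brace_star c) k}"

definition id_add :: "('a::ab_group_add \<times> int) \<Rightarrow> ('a \<times> int) \<Rightarrow> ('a \<times> int)" where
  "id_add x y = (fst x + fst y, snd x + snd y)"

definition id_mult :: "('a::ab_group_add \<Rightarrow> 'a \<Rightarrow> 'a) \<Rightarrow> ('a \<times> int) \<Rightarrow> ('a \<times> int) \<Rightarrow> ('a \<times> int)" where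
  "id_mult m x y = (m (fst x) (fst y) + zmul (snd x) (fst y) + zmul (snd y) (fst x), snd x * snd y)"

definition inv_fact :: "nat \<Rightarrow> nat \<Rightarrow> nat \<Rightarrow> int" where
  "inv_fact p n j = (SOME u. [int (fact j) * u = 1] (mod int (p ^ n)))"

text \<open>e^{L_a}(x) = sum_{j=0..n} (1/j!) L_a^j(x) on A^id (the terms j > n vanish
  since A^{n+1} = 0; for j \<ge> 1 the term lies in A, the j = 0 term is x).\<close>
definition expL :: "nat \<Rightarrow> nat \<Rightarrow> ('a::ab_group_add \<Rightarrow> 'a \<Rightarrow> 'a) \<Rightarrow> 'a \<Rightarrow> ('a \<times> int) \<Rightarrow> ('a \<times> int)" where
  "expL p n m a x =
     (let t = (\<lambda>j. ((id_mult m (a, 0)) ^^ j) x) in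
      id_add x ((\<Sum>j\<in>{1..n}. zmul (inv_fact p n j) (fst (t j))),
                (\<Sum>j\<in>{1..n}. inv_fact p n j * snd (t j))))"

definition flowW :: "nat \<Rightarrow> nat \<Rightarrow> ('a::ab_group_add \<Rightarrow> 'a \<Rightarrow> 'a) \<Rightarrow> 'a \<Rightarrow> 'a" where
  "flowW p n m a = fst (id_add (expL p n m a (0, 1)) (0, - 1))"

definition flowOmega :: "nat \<Rightarrow> nat \<Rightarrow> ('a::ab_group_add \<Rightarrow> 'a \<Rightarrow> 'a) \<Rightarrow> 'a \<Rightarrow> 'a" where
  "flowOmega p n m = inv_into UNIV (flowW p n m)"

definition group_of_flows :: "nat \<Rightarrow> nat \<Rightarrow> ('a::ab_group_add \<Rightarrow> 'a \<Rightarrow> 'a) \<Rightarrow> ('a \<Rightarrow> 'a \<Rightarrow> 'a)" where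
  "group_of_flows p n m = (\<lambda>a b. a + fst (expL p n m (flowOmega p n m a) (b, 0)))"

definition assoc_dot :: "nat \<Rightarrow> nat \<Rightarrow> ('a::ab_group_add \<Rightarrow> 'a \<Rightarrow> 'a) \<Rightarrow> 'a \<Rightarrow> 'a \<Rightarrow> 'a" where
  "assoc_dot p \<gamma> c a b =
     (let \<xi> = \<gamma> ^ (p ^ (p - 1)) in
      \<Sum>i\<in>{0..p - 2}. zmul (int (\<xi> ^ (p - 1 - i))) (brace_star c (zmul (int (\<xi> ^ i)) a) b))"

definition assoc_prelie :: "nat \<Rightarrow> nat \<Rightarrow> nat \<Rightarrow> ('a::ab_group_add \<Rightarrow> 'a \<Rightarrow> 'a) \<Rightarrow> ('a \<Rightarrow> 'a \<Rightarrow> 'a)" where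
  "assoc_prelie p n \<gamma> c =
     (\<lambda>a b. zmul (- int (\<Sum>i<n. p ^ i)) (assoc_dot p \<gamma> c a b))"

end

theory Submission
  imports
    Defs
    "HOL-Computational_Algebra.Formal_Power_Series"
    "HOL-Combinatorics.Stirling"
    "HOL-Library.Product_Plus"
begin

text \<open>
  Since \<open>A\<^sup>[\<^sup>k\<^sup>] = 0\<close> with \<open>k < p\<close>, every map that occurs is polynomial of degree less than \<open>p - 1\<close>, and
  the averaging over powers of \<open>\<xi>\<close> in the definition of the associated pre-Lie ring extracts
  linear coefficients, that is, derivatives at \<open>0\<close>.

  From braces to pre-Lie rings: maps that are polynomial with respect to the strong series, in the sense that
  every difference raises the weight, are closed under \<open>*\<close>.  If \<open>f\<close> is a polynomial path through \<open>0\<close> then the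
  derivative of \<open>f(t) * g(t)\<close> at \<open>0\<close> is \<open>f'(0) \<odot> g(0)\<close>.  The path \<open>(t a) \<circ> (t c)\<close> gives additivity of \<open>\<odot>\<close>;
  the associator of \<open>\<odot>\<close> is a mixed second derivative, hence symmetric; and the path of circle powers
  of \<open>a\<close> satisfies the differential equation of a flow, so \<open>\<circ>\<close> is the group of flows of \<open>\<odot>\<close>.

  From pre-Lie rings to braces: associativity of the group of flows says
  \<open>e\<^bsup>L x\<^esup> e\<^bsup>L y\<^esup> = e\<^bsup>L z\<^esup>\<close> whenever \<open>W z = W x + e\<^bsup>L x\<^esup> (W y)\<close>.  Replacing \<open>x\<close> by \<open>t x\<close>, both sides solve the
  same linear differential equation in \<open>t\<close>, by the formula for the derivative of the exponential.

  The two constructions respect the strong series in both directions, which gives equality of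
  the nilpotency indices.
\<close>

section \<open>Integer multiples and additive maps\<close>

lemma zmul_0_left: "zmul 0 x = 0"
  by (simp add: zmul_def)

lemma zmul_add_one: "zmul (i + 1) x = zmul i x + x"
proof (cases "i \<ge> 0")
  case True
  then have "nat (i + 1) = Suc (nat i)" by simp
  then show ?thesis using True by (simp add: zmul_def)
next
  case False
  then have "nat (- i) = Suc (nat (- (i + 1)))" by simp
  then show ?thesis using False by (auto simp: zmul_def)
qed

lemma zmul_1_left: "zmul 1 x = x"
  using zmul_add_one[of 0 x] by (simp add: zmul_0_left)

lemma additive_int_eq_zmul:
  assumes "additive f"
  shows "f i = zmul i (f 1)"
proof -
  interpret additive f by fact
  show ?thesis
  proof (induction i rule: int_induct[where k = 0])
    case base
    show ?case by (simp add: zero zmul_0_left)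
  next
    case (step1 i)
    then show ?case by (simp add: add zmul_add_one)
  next
    case (step2 i)
    then show ?case using zmul_add_one[of "i - 1" "f 1"] by (simp add: diff algebra_simps)
  qed
qed

lemma zmul_add_left: "zmul (i + j) x = zmul i x + zmul j x"
proof (induction i rule: int_induct[where k = 0])
  case base
  then show ?case by (simp add: zmul_0_left)
next
  case (step1 i)
  then show ?case using zmul_add_one[of "i + j" x] zmul_add_one[of i x] by (simp add: algebra_simps)
next
  case (step2 i)
  then show ?case using zmul_add_one[of "i - 1 + j" x] zmul_add_one[of "i - 1" x] by (simp add: algebra_simps)
qed

lemma (in additive) zmul: "f (zmul i x) = zmul i (f x)"
proof -
  have "additive (\<lambda>i. f (zmul i x))" by unfold_locales (simp add: zmul_add_left add)
  from additive_int_eq_zmul[OF this] show ?thesis by (simp add: zmul_1_left)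
qed

interpretation zmul: Modules.module "zmul :: int \<Rightarrow> 'a::ab_group_add \<Rightarrow> 'a"
proof
  fix i j :: int and x y :: 'a
  have "additive (\<lambda>i. zmul i x + zmul i y)" by unfold_locales (simp add: zmul_add_left)
  from additive_int_eq_zmul[OF this] show "zmul i (x + y) = zmul i x + zmul i y"
    by (simp add: zmul_1_left)
  have "additive (\<lambda>i. zmul (i * j) x)" by unfold_locales (simp add: zmul_add_left algebra_simps)
  from additive_int_eq_zmul[OF this] show "zmul i (zmul j x) = zmul (i * j) x"
    by simp
qed (rule zmul_add_left zmul_1_left)+

lemma additive_zmul: "additive (zmul r)"
  by unfold_locales (rule zmul.scale_right_distrib)

lemma additive_funpow: "additive f \<Longrightarrow> additive (f ^^ j)" for f :: "'a::ab_group_add \<Rightarrow> 'a"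
  by (induction j) (auto simp: additive_def)

lemma zmul_card_eq_zero: "zmul (int (card (UNIV :: 'a set))) (x :: 'a::{ab_group_add, finite}) = 0"
proof -
  have "(\<Sum>y\<in>UNIV. y + x) = (\<Sum>y\<in>UNIV. y)"
    by (rule sum.reindex_bij_witness[of _ "\<lambda>y. y - x" "\<lambda>y. y + x"]) auto
  then have "(\<Sum>y\<in>(UNIV::'a set). x) = 0" by (simp add: sum.distrib)
  moreover have "(\<Sum>y\<in>S. x) = zmul (int (card S)) x" if "finite S" for S :: "'a set"
    using that by (induction S rule: finite_induct) (simp_all add: zmul_add_left)
  ultimately show ?thesis by simp
qed

section \<open>Binomial sums and finite differences\<close>

lemma sum_zmul_binomial_Suc:
  fixes B :: "nat \<Rightarrow> 'a::ab_group_add"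
  shows "(\<Sum>i\<le>Suc n. zmul (int (Suc n choose i)) (B i)) =
    (\<Sum>i\<le>n. zmul (int (n choose i)) (B i + B (Suc i)))"
proof -
  have "(\<Sum>i\<le>Suc n. zmul (int (Suc n choose i)) (B i)) =
      (B 0 + (\<Sum>i\<le>n. zmul (int (n choose Suc i)) (B (Suc i)))) + (\<Sum>i\<le>n. zmul (int (n choose i)) (B (Suc i)))"
    by (subst sum.atMost_Suc_shift) (simp add: zmul_add_left sum.distrib add_ac)
  also have "B 0 + (\<Sum>i\<le>n. zmul (int (n choose Suc i)) (B (Suc i))) = (\<Sum>i\<le>Suc n. zmul (int (n choose i)) (B i))"
    by (subst sum.atMost_Suc_shift) simp
  finally show ?thesis
    by (simp add: zmul.scale_right_distrib sum.distrib binomial_eq_0)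
qed

lemma sum_square_eq_triangle:
  fixes T :: "nat \<Rightarrow> nat \<Rightarrow> 'a::comm_monoid_add"
  assumes "\<And>i l. i + l \<ge> M \<Longrightarrow> T i l = 0"
  shows "(\<Sum>i<M. \<Sum>l<M. T i l) = (\<Sum>j<M. \<Sum>i\<le>j. T i (j - i))"
proof -
  have "(\<Sum>i<M. \<Sum>l<M. T i l) = (\<Sum>(i, l)\<in>{..<M} \<times> {..<M}. T i l)"
    by (rule sum.cartesian_product)
  also have "\<dots> = (\<Sum>(i, l)\<in>{(i, l). i + l < M}. T i l)"
    using assms by (intro sum.mono_neutral_right) (auto simp: not_less[symmetric])
  also have "\<dots> = (\<Sum>j<M. \<Sum>i\<le>j. T i (j - i))"
    by (rule sum.triangle_reindex)
  finally show ?thesis .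
qed

definition forward_diff :: "'m::plus \<Rightarrow> ('m \<Rightarrow> 'a::ab_group_add) \<Rightarrow> 'm \<Rightarrow> 'a" where
  "forward_diff h \<phi> x = \<phi> (x + h) - \<phi> x"

lemma newton_forward_difference:
  "\<phi> (((\<lambda>y. y + h) ^^ t) x) = (\<Sum>l\<le>t. zmul (int (t choose l)) ((forward_diff h ^^ l) \<phi> x))"
proof (induction t arbitrary: x)
  case 0
  then show ?case by simp
next
  case (Suc t)
  have "\<phi> (((\<lambda>y. y + h) ^^ Suc t) x) = (\<Sum>l\<le>t. zmul (int (t choose l)) ((forward_diff h ^^ l) \<phi> (x + h)))"
    by (simp only: funpow_Suc_right o_apply Suc)
  also have "\<dots> = (\<Sum>l\<le>t. zmul (int (t choose l)) ((forward_diff h ^^ l) \<phi> x + (forward_diff h ^^ Suc l) \<phi> x))"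
    by (simp add: forward_diff_def)
  also have "\<dots> = (\<Sum>l\<le>Suc t. zmul (int (Suc t choose l)) ((forward_diff h ^^ l) \<phi> x))"
    by (rule sum_zmul_binomial_Suc[symmetric])
  finally show ?case .
qed

definition signed_stirling :: "nat \<Rightarrow> nat \<Rightarrow> int" where
  "signed_stirling l j = (- 1) ^ (l + j) * int (stirling l j)"

lemma sum_signed_stirling_power:
  "(\<Sum>j\<le>l. signed_stirling l j * int t ^ j) = int (fact l * (t choose l))"
proof -
  have "real_of_int (pochhammer (- int t) l) = (- 1) ^ l * real (fact l * (t choose l))"
    by (simp add: pochhammer_of_int[symmetric] binomial_gbinomial gbinomial_pochhammer)
  then have poch: "pochhammer (- int t) l = (- 1) ^ l * int (fact l * (t choose l))"
    by (metis (mono_tags, lifting) of_int_1 of_int_eq_iff of_int_minus of_int_mult of_int_of_nat_eq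
        of_int_power)
  have "(\<Sum>j\<le>l. signed_stirling l j * int t ^ j) = (- 1) ^ l * (\<Sum>j\<le>l. int (stirling l j) * (- int t) ^ j)"
    unfolding sum_distrib_left signed_stirling_def
    by (intro sum.cong refl) (simp add: power_add power_minus[of "int t"])
  also have "\<dots> = (- 1) ^ l * ((- 1) ^ l * int (fact l * (t choose l)))"
    unfolding poch[symmetric] using stirling_pochhammer[of l "- int t"] by simp
  finally show ?thesis by (simp flip: power_add add: mult_2[symmetric] mult.assoc[symmetric])
qed

section \<open>Filtered groups\<close>

locale filtration =
  fixes k :: nat and F :: "nat \<Rightarrow> 'a::ab_group_add set"
  assumes k_ge_2: "2 \<le> k"
    and F_zero: "0 \<in> F i"
    and F_diff: "a \<in> F i \<Longrightarrow> b \<in> F i \<Longrightarrow> a - b \<in> F i"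
    and F_Suc: "F (Suc i) \<subseteq> F i"
    and F_k: "a \<in> F k \<Longrightarrow> a = 0"
    and F_0_subset_F_1: "F 0 \<subseteq> F 1"
begin

lemma F_uminus: "a \<in> F i \<Longrightarrow> - a \<in> F i"
  using F_diff[OF F_zero] by (metis diff_0)

lemma F_add: "a \<in> F i \<Longrightarrow> b \<in> F i \<Longrightarrow> a + b \<in> F i"
  using F_diff[OF _ F_uminus] by (metis diff_minus_eq_add)

lemma F_sum: "(\<And>x. x \<in> S \<Longrightarrow> f x \<in> F i) \<Longrightarrow> sum f S \<in> F i"
  by (induction S rule: infinite_finite_induct) (auto intro: F_zero F_add)

lemma F_zmul:
  assumes "a \<in> F i"
  shows "zmul r a \<in> F i"
proof (induction r rule: int_induct[where k = 0])
  case base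
  then show ?case by (simp add: F_zero)
next
  case (step1 r)
  then show ?case by (simp add: zmul_add_one F_add assms)
next
  case (step2 r)
  then show ?case using F_diff[OF _ assms] by (simp add: zmul.scale_left_diff_distrib)
qed

lemma F_antimono: "a \<in> F j \<Longrightarrow> i \<le> j \<Longrightarrow> a \<in> F i"
  using lift_Suc_antimono_le[of F i j] F_Suc by blast

lemma F_eq_zero: "a \<in> F i \<Longrightarrow> k \<le> i \<Longrightarrow> a = 0"
  using F_antimono F_k by blast

lemma F_0_imp_F_1: "a \<in> F 0 \<Longrightarrow> a \<in> F (Suc 0)"
  using F_0_subset_F_1 by auto

lemma lessThan_k_eq: "{..<k} = insert 0 {1..<k}"
  using k_ge_2 by auto

definition filtered_hom :: "nat \<Rightarrow> ('a \<Rightarrow> 'a) \<Rightarrow> bool" where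
  "filtered_hom d f \<longleftrightarrow> additive f \<and> (\<forall>i. \<forall>x\<in>F i. f x \<in> F (i + d))"

lemma filtered_homI:
  assumes "\<And>x y. f (x + y) = f x + f y" "\<And>i x. x \<in> F i \<Longrightarrow> f x \<in> F (i + d)"
  shows "filtered_hom d f"
  unfolding filtered_hom_def using assms by (auto intro: additive.intro)

lemma filtered_hom_additive: "filtered_hom d f \<Longrightarrow> additive f"
  by (simp add: filtered_hom_def)

lemma filtered_hom_F: "filtered_hom d f \<Longrightarrow> x \<in> F i \<Longrightarrow> f x \<in> F (i + d)"
  by (simp add: filtered_hom_def)

lemma filtered_hom_zmul: "filtered_hom 0 (zmul r)"
  by (intro filtered_homI) (simp_all add: zmul.scale_right_distrib F_zmul)

lemma filtered_hom_compose:
  "filtered_hom d f \<Longrightarrow> filtered_hom e g \<Longrightarrow> filtered_hom (d + e) (\<lambda>x. f (g x))"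
  using filtered_hom_F[of d f _ "_ + e"]
  by (intro filtered_homI) (simp_all add: additive.add[OF filtered_hom_additive] filtered_hom_F ac_simps)

lemma filtered_hom_funpow: "filtered_hom d f \<Longrightarrow> filtered_hom (j * d) (f ^^ j)"
proof (induction j)
  case 0
  then show ?case by (auto intro: filtered_homI)
next
  case (Suc j)
  then show ?case using filtered_hom_compose[of d f "j * d" "f ^^ j"] by (simp add: o_def)
qed

lemma funpow_F: "filtered_hom 1 f \<Longrightarrow> x \<in> F 0 \<Longrightarrow> (f ^^ j) x \<in> F (Suc j)"
  using filtered_hom_F[OF filtered_hom_funpow F_0_imp_F_1] by fastforce

lemma funpow_eq_zero: "filtered_hom 1 f \<Longrightarrow> x \<in> F 0 \<Longrightarrow> k \<le> Suc j \<Longrightarrow> (f ^^ j) x = 0"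
  by (rule F_eq_zero[OF funpow_F])

definition near_identity :: "('a \<Rightarrow> 'a) \<Rightarrow> bool" where
  "near_identity g \<longleftrightarrow> g 0 = 0 \<and>
     (\<forall>i. \<forall>a\<in>F 0. \<forall>b\<in>F 0. a - b \<in> F i \<longrightarrow> g a - g b - (a - b) \<in> F (Suc i))"

lemma near_identityD:
  "near_identity g \<Longrightarrow> a \<in> F 0 \<Longrightarrow> b \<in> F 0 \<Longrightarrow> a - b \<in> F i \<Longrightarrow> g a - g b - (a - b) \<in> F (Suc i)"
  by (auto simp: near_identity_def)

lemma near_identity_diff_self: "near_identity g \<Longrightarrow> a \<in> F 0 \<Longrightarrow> a \<in> F i \<Longrightarrow> g a - a \<in> F (Suc i)"
  using near_identityD[of g a 0 i] F_zero by (simp add: near_identity_def)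

lemma near_identity_add_filtered_hom:
  assumes "filtered_hom 1 f"
  shows "near_identity (\<lambda>x. x + f x)"
proof -
  interpret additive f using assms by (rule filtered_hom_additive)
  show ?thesis
    using filtered_hom_F[OF assms] by (auto simp: near_identity_def zero simp flip: diff)
qed

lemma near_identity_mem_iff:
  assumes g: "near_identity g" and "a \<in> F 0"
  shows "g a \<in> F i \<longleftrightarrow> a \<in> F i"
proof
  assume "a \<in> F i"
  then have "g a - a \<in> F i"
    using near_identity_diff_self[OF g \<open>a \<in> F 0\<close>] F_Suc by blast
  from F_add[OF this \<open>a \<in> F i\<close>] show "g a \<in> F i" by simp
next
  show "g a \<in> F i \<Longrightarrow> a \<in> F i"
  proof (induction i)
    case 0
    then show ?case using \<open>a \<in> F 0\<close> by simp
  next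
    case (Suc i)
    then have "a \<in> F i" using F_Suc by blast
    with F_diff[OF Suc.prems near_identity_diff_self[OF g \<open>a \<in> F 0\<close>]] show ?case by simp
  qed
qed

lemma near_identity_bij_betw:
  assumes g: "near_identity g"
  shows "bij_betw g (F 0) (F 0)"
proof -
  have "inj_on g (F 0)"
  proof (rule inj_onI)
    fix a b assume ab: "a \<in> F 0" "b \<in> F 0" "g a = g b"
    have "a - b \<in> F i" for i
    proof (induction i)
      case (Suc i)
      then have "- (a - b) \<in> F (Suc i)" using near_identityD[OF g ab(1,2)] ab(3) by simp
      then show ?case using F_uminus by fastforce
    qed (use ab F_diff in blast)
    then show "a = b" using F_k by fastforce
  qed
  moreover have "w \<in> g ` F 0" if "w \<in> F 0" for w
  proof -
    have "\<exists>z\<in>F 0. w - g z \<in> F i" for i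
    proof (induction i)
      case 0
      have "g 0 = 0" using g by (simp add: near_identity_def)
      then show ?case using that F_zero by (intro bexI[of _ 0]) auto
    next
      case (Suc i)
      then obtain z where z: "z \<in> F 0" "w - g z \<in> F i" by blast
      let ?z = "z + (w - g z)"
      have z': "?z \<in> F 0" using z F_add F_antimono by blast
      have "- (g ?z - g z - (?z - z)) \<in> F (Suc i)"
        by (intro F_uminus near_identityD[OF g] z') (use z in simp_all)
      then show ?case using z' by (intro bexI[of _ ?z]) auto
    qed
    then show ?thesis using F_k by (metis image_eqI right_minus_eq)
  qed
  ultimately show ?thesis
    using near_identity_mem_iff[OF g, of _ 0] by (auto simp: bij_betw_def)
qed

end

lemma cong_fact_inv_fact:
  assumes "prime p" "j < p"
  shows "[int (fact j) * inv_fact p n j = 1] (mod int (p ^ n))"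
proof -
  have "coprime (fact j) (p ^ n)"
    using assms
    by (metis coprime_commute coprime_power_left_iff linorder_not_less prime_dvd_fact_iff prime_imp_coprime)
  then have "coprime (int (fact j)) (int (p ^ n))"
    using coprime_int_iff by blast
  then have "\<exists>u. [int (fact j) * u = 1] (mod int (p ^ n))"
    by (rule cong_solve_coprime_int)
  then show ?thesis unfolding inv_fact_def by (rule someI_ex)
qed

locale torsion_filtration = filtration k F
  for k and F :: "nat \<Rightarrow> 'a::ab_group_add set" +
  fixes p n :: nat
  assumes prime_p: "prime p" and k_less_p: "k < p"
    and torsion: "zmul (int (p ^ n)) (x::'a) = 0"
begin

abbreviation inv_factorial :: "nat \<Rightarrow> int" where
  "inv_factorial \<equiv> inv_fact p n"

lemma zmul_cong:
  assumes "[r = s] (mod int (p ^ n))"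
  shows "zmul r (x::'a) = zmul s x"
proof -
  obtain d where "r = s + d * int (p ^ n)"
    using assms by (metis cong_iff_lin cong_sym mult.commute)
  then show ?thesis
    by (simp only: zmul_add_left zmul.scale_scale[symmetric] torsion zmul.scale_zero_right add_0_right)
qed

lemma zmul_fact_inv_factorial: "j < p \<Longrightarrow> zmul (int (fact j) * inv_factorial j) (x::'a) = x"
  using zmul_cong[OF cong_fact_inv_fact[OF prime_p]] by simp

lemma zmul_fact_cancel:
  assumes "j < p" "zmul (int (fact j)) (x::'a) = zmul (int (fact j)) y"
  shows "x = y"
  by (metis assms zmul_fact_inv_factorial zmul.scale_scale mult.commute)

lemma zmul_nat_cancel:
  assumes "0 < j" "j < p" "zmul (int j) (x::'a) = zmul (int j) y"
  shows "x = y"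
proof (rule zmul_fact_cancel[OF \<open>j < p\<close>])
  have "int (fact j) = int (fact (j - 1)) * int j"
    using \<open>0 < j\<close> by (metis fact_reduce mult.commute of_nat_fact of_nat_mult)
  then show "zmul (int (fact j)) x = zmul (int (fact j)) y"
    using assms(3) by (metis zmul.scale_scale)
qed

lemma inv_factorial_0 [simp]: "zmul (inv_factorial 0) (x::'a) = x"
  using zmul_fact_inv_factorial[of 0] prime_gt_0_nat[OF prime_p] by simp

lemma inv_factorial_1 [simp]: "zmul (inv_factorial (Suc 0)) (x::'a) = x"
  using zmul_fact_inv_factorial[of 1] prime_gt_1_nat[OF prime_p] by simp

lemma inv_factorial_Suc:
  assumes "Suc j < p"
  shows "zmul (int (Suc j)) (zmul (inv_factorial (Suc j)) (x::'a)) = zmul (inv_factorial j) x"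
proof (rule zmul_fact_cancel)
  show "j < p" using assms by simp
  have "int (fact j) * (int (Suc j) * inv_factorial (Suc j)) = int (fact (Suc j)) * inv_factorial (Suc j)"
    by (simp add: algebra_simps)
  then show "zmul (int (fact j)) (zmul (int (Suc j)) (zmul (inv_factorial (Suc j)) x)) =
      zmul (int (fact j)) (zmul (inv_factorial j) x)"
    by (metis Suc_lessD assms zmul_fact_inv_factorial zmul.scale_scale)
qed

lemma inv_factorial_binomial:
  assumes "j < p" "i \<le> j"
  shows "zmul (inv_factorial j) (zmul (int (j choose i)) (x::'a)) =
    zmul (inv_factorial i) (zmul (inv_factorial (j - i)) x)"
proof (rule zmul_fact_cancel[OF \<open>j < p\<close>])
  let ?x = "zmul (int (j choose i)) x"
  have fact_j: "int (fact j) = int (fact i) * int (fact (j - i)) * int (j choose i)"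
    using binomial_fact_lemma[OF \<open>i \<le> j\<close>] by (metis of_nat_mult)
  have "zmul (int (fact j)) (zmul (inv_factorial j) ?x) = ?x"
    using zmul_fact_inv_factorial[OF \<open>j < p\<close>, of ?x] by (simp add: mult.assoc)
  also have "\<dots> = zmul (int (fact i) * inv_factorial i) (zmul (int (fact (j - i)) * inv_factorial (j - i)) ?x)"
    using assms by (simp only: zmul_fact_inv_factorial less_imp_diff_less le_less_trans)
  also have "\<dots> = zmul (int (fact j)) (zmul (inv_factorial i) (zmul (inv_factorial (j - i)) x))"
    unfolding fact_j by (simp add: algebra_simps)
  finally show "zmul (int (fact j)) (zmul (inv_factorial j) ?x) =
      zmul (int (fact j)) (zmul (inv_factorial i) (zmul (inv_factorial (j - i)) x))" .
qed

text \<open>The \<open>\<phi>\<close>-functions of exponential integrators: \<open>phi 0 f = e\<^bsup>f\<^esup>\<close> and \<open>phi 1 f = (e\<^bsup>f\<^esup> - 1) / f\<close>.\<close>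

definition phi :: "nat \<Rightarrow> ('a \<Rightarrow> 'a) \<Rightarrow> 'a \<Rightarrow> 'a" where
  "phi r f x = (\<Sum>j<k. zmul (inv_factorial (j + r)) ((f ^^ j) x))"

lemma additive_phi:
  assumes "additive f"
  shows "additive (phi r f)"
proof
  fix x y
  show "phi r f (x + y) = phi r f x + phi r f y"
    using additive.add[OF additive_funpow[OF assms]]
    by (simp add: phi_def zmul.scale_right_distrib sum.distrib)
qed

lemma phi_eq_head:
  assumes "additive f" "f x = 0"
  shows "phi r f x = zmul (inv_factorial r) x"
proof -
  have "(f ^^ j) x = 0" if "j \<noteq> 0" for j
    using that assms additive.zero[OF additive_funpow[OF assms(1)]]
    by (cases j) (simp_all add: funpow_Suc_right del: funpow.simps)
  then show ?thesis unfolding phi_def lessThan_k_eq by simp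
qed

lemma phi_Suc_k:
  assumes "filtered_hom 1 f" "x \<in> F 0"
  shows "phi r f x = (\<Sum>j<Suc k. zmul (inv_factorial (j + r)) ((f ^^ j) x))"
  by (simp add: phi_def funpow_eq_zero[OF assms])

lemma phi_F: "filtered_hom d f \<Longrightarrow> x \<in> F i \<Longrightarrow> phi r f x \<in> F i"
  unfolding phi_def by (intro F_sum F_zmul F_antimono[OF filtered_hom_F[OF filtered_hom_funpow]]) auto

lemma filtered_hom_phi_0_diff:
  assumes "filtered_hom d f"
  shows "filtered_hom d (\<lambda>x. phi 0 f x - x)"
proof (rule filtered_homI)
  show "phi 0 f (x + y) - (x + y) = phi 0 f x - x + (phi 0 f y - y)" for x y
    using additive.add[OF additive_phi[OF filtered_hom_additive[OF assms]]] by simp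
  show "phi 0 f x - x \<in> F (i + d)" if "x \<in> F i" for i x
  proof -
    have "phi 0 f x - x = (\<Sum>j\<in>{1..<k}. zmul (inv_factorial j) ((f ^^ j) x))"
      unfolding phi_def lessThan_k_eq by simp
    also have "\<dots> \<in> F (i + d)"
      by (intro F_sum F_zmul F_antimono[OF filtered_hom_F[OF filtered_hom_funpow[OF assms] that]]) auto
    finally show ?thesis .
  qed
qed

lemma near_identity_phi_0: "filtered_hom 1 f \<Longrightarrow> near_identity (phi 0 f)"
  using near_identity_add_filtered_hom[OF filtered_hom_phi_0_diff, of f] by simp

text \<open>If \<open>S\<^sub>0, S\<^sub>1, \<dots>\<close> are operators with \<open>S\<^sub>i\<^sub>+\<^sub>1 = [f, S\<^sub>i]\<close> and \<open>G i l = S\<^sub>i f\<^sup>l x\<close>, this is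
  \<open>e\<^bsup>f\<^esup> S\<^sub>0 = (\<Sum>\<^sub>i S\<^sub>i / i!) e\<^bsup>f\<^esup>\<close>.\<close>

lemma funpow_leibniz:
  assumes "additive f" "\<And>i l. f (G i l) = G (Suc i) l + G i (Suc l)"
  shows "(f ^^ j) (G 0 0) = (\<Sum>i\<le>j. zmul (int (j choose i)) (G i (j - i)))"
proof (induction j)
  case 0
  then show ?case by simp
next
  case (Suc j)
  interpret additive f by fact
  have "(f ^^ Suc j) (G 0 0) = (\<Sum>i\<le>j. zmul (int (j choose i)) (G i (Suc j - i) + G (Suc i) (Suc j - Suc i)))"
    by (simp add: Suc sum zmul assms(2) Suc_diff_le add.commute)
  then show ?case unfolding sum_zmul_binomial_Suc .
qed

lemma exp_leibniz:
  fixes G :: "nat \<Rightarrow> nat \<Rightarrow> 'a"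
  assumes "additive f" "\<And>i l. f (G i l) = G (Suc i) l + G i (Suc l)"
    and G_eq_zero: "\<And>i l. k \<le> i + l \<Longrightarrow> G i l = 0"
  shows "phi 0 f (G 0 0) = (\<Sum>i<Suc k. zmul (inv_factorial i) (\<Sum>l<Suc k. zmul (inv_factorial l) (G i l)))"
proof -
  have "phi 0 f (G 0 0) = (\<Sum>j<k. \<Sum>i\<le>j. zmul (inv_factorial j) (zmul (int (j choose i)) (G i (j - i))))"
    by (simp only: phi_def funpow_leibniz[of f G, OF assms(1,2)] zmul.scale_sum_right add_0_right)
  also have "\<dots> = (\<Sum>j<k. \<Sum>i\<le>j. zmul (inv_factorial i) (zmul (inv_factorial (j - i)) (G i (j - i))))"
    using k_less_p by (intro sum.cong refl inv_factorial_binomial) auto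
  also have "\<dots> = (\<Sum>i<k. \<Sum>l<k. zmul (inv_factorial i) (zmul (inv_factorial l) (G i l)))"
    by (rule sum_square_eq_triangle[symmetric]) (simp only: G_eq_zero zmul.scale_zero_right)
  also have "\<dots> = (\<Sum>i<Suc k. zmul (inv_factorial i) (\<Sum>l<Suc k. zmul (inv_factorial l) (G i l)))"
    by (simp add: G_eq_zero zmul.scale_sum_right)
  finally show ?thesis .
qed

end

section \<open>Filtered algebras\<close>

locale filtered_algebra = torsion_filtration k F p n
  for k and F :: "nat \<Rightarrow> 'a::ab_group_add set" and p n +
  fixes m :: "'a \<Rightarrow> 'a \<Rightarrow> 'a"
  assumes mult_add_left: "m (x + y) z = m x z + m y z"
    and mult_add_right: "m x (y + z) = m x y + m x z"
    and F_mult: "x \<in> F i \<Longrightarrow> y \<in> F j \<Longrightarrow> m x y \<in> F (i + j)"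
begin

sublocale mult_left: additive "\<lambda>x. m x z" for z
  by unfold_locales (rule mult_add_left)

sublocale mult_right: additive "m z" for z
  by unfold_locales (rule mult_add_right)

lemma filtered_hom_mult: "a \<in> F i \<Longrightarrow> filtered_hom i (m a)"
  by (intro filtered_homI mult_add_right) (metis F_mult add.commute)

lemma filtered_hom_mult_F_0: "a \<in> F 0 \<Longrightarrow> filtered_hom 1 (m a)"
  using filtered_hom_mult[of a 1] F_0_imp_F_1 by simp

lemma funpow_mult_zmul: "(m (zmul r a) ^^ j) x = zmul (r ^ j) ((m a ^^ j) x)"
  by (induction j) (auto simp: mult_right.zmul mult_left.zmul mult.commute)

abbreviation E :: "'a \<Rightarrow> 'a \<Rightarrow> 'a" where
  "E a \<equiv> phi 0 (m a)"

definition W :: "'a \<Rightarrow> 'a" where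
  "W a = phi 1 (m a) a"

sublocale E: additive "E a" for a
  by (rule additive_phi) (rule mult_right.additive_axioms)

lemma E_0_left [simp]: "E 0 x = x"
  using phi_eq_head[OF mult_right.additive_axioms, of 0 x 0] by (simp add: mult_left.zero)

lemma W_0 [simp]: "W 0 = 0"
  unfolding W_def by (rule additive.zero[OF additive_phi]) (rule mult_right.additive_axioms)

lemma E_F: "a \<in> F 0 \<Longrightarrow> x \<in> F i \<Longrightarrow> E a x \<in> F i"
  by (rule phi_F[OF filtered_hom_mult_F_0])

lemma E_diff_self_F: "a \<in> F i \<Longrightarrow> x \<in> F j \<Longrightarrow> E a x - x \<in> F (i + j)"
  using filtered_hom_F[OF filtered_hom_phi_0_diff[OF filtered_hom_mult]] by (metis add.commute)

lemma funpow_mult_self_diff_F: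
  assumes "a \<in> F 0" "b \<in> F 0" "a - b \<in> F i"
  shows "(m a ^^ j) a - (m b ^^ j) b \<in> F (i + j)"
proof (induction j)
  case 0
  then show ?case using assms by simp
next
  case (Suc j)
  have "(m a ^^ Suc j) a - (m b ^^ Suc j) b = m a ((m a ^^ j) a - (m b ^^ j) b) + m (a - b) ((m b ^^ j) b)"
    by (simp add: mult_left.diff mult_right.diff)
  also have "\<dots> \<in> F (i + Suc j)"
  proof (intro F_add)
    show "m a ((m a ^^ j) a - (m b ^^ j) b) \<in> F (i + Suc j)"
      using filtered_hom_F[OF filtered_hom_mult_F_0[OF assms(1)] Suc] by simp
    show "m (a - b) ((m b ^^ j) b) \<in> F (i + Suc j)"
      by (rule F_mult[OF assms(3) funpow_F[OF filtered_hom_mult_F_0[OF assms(2)] assms(2)]])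
  qed
  finally show ?case .
qed

lemma near_identity_W: "near_identity W"
  unfolding near_identity_def
proof (intro conjI allI ballI impI)
  fix i a b assume ab: "a \<in> F 0" "b \<in> F 0" "a - b \<in> F i"
  have "W a - W b - (a - b) = (\<Sum>j\<in>{1..<k}. zmul (inv_factorial (Suc j)) ((m a ^^ j) a - (m b ^^ j) b))"
    unfolding W_def phi_def lessThan_k_eq by (simp add: zmul.scale_right_diff_distrib sum_subtractf)
  also have "\<dots> \<in> F (Suc i)"
    by (intro F_sum F_zmul F_antimono[OF funpow_mult_self_diff_F[OF ab]]) auto
  finally show "W a - W b - (a - b) \<in> F (Suc i)" .
qed simp

lemmas bij_betw_W = near_identity_bij_betw[OF near_identity_W]
  and W_F_iff = near_identity_mem_iff[OF near_identity_W]

definition bch :: "'a \<Rightarrow> 'a \<Rightarrow> 'a" where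
  "bch x y = inv_into (F 0) W (W x + E x (W y))"

lemma bch:
  assumes "x \<in> F 0" "y \<in> F 0"
  shows bch_F: "bch x y \<in> F 0" and W_bch: "W (bch x y) = W x + E x (W y)"
proof -
  have "W x + E x (W y) \<in> W ` F 0"
    using assms W_F_iff bij_betw_W by (auto simp: bij_betw_def intro!: F_add E_F)
  then show "bch x y \<in> F 0" "W (bch x y) = W x + E x (W y)"
    unfolding bch_def by (rule inv_into_into, rule f_inv_into_f)
qed

lemma bch_eqI:
  assumes "x \<in> F 0" "y \<in> F 0" "z \<in> F 0" "W z = W x + E x (W y)"
  shows "bch x y = z"
  using assms(4)[folded W_bch[OF assms(1,2)]] bij_betw_W bch_F[OF assms(1,2)] assms(3)
  by (auto simp: bij_betw_def inj_on_def)

lemma bch_0_left: "y \<in> F 0 \<Longrightarrow> bch 0 y = y"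
  by (rule bch_eqI) (simp_all add: F_zero)

end

locale filtered_algebra_hom =
  src: filtered_algebra k F' p n m' + tgt: filtered_algebra k F p n m
  for k and F' :: "nat \<Rightarrow> 'b::ab_group_add set" and p n m' and F :: "nat \<Rightarrow> 'a::ab_group_add set" and m +
  fixes h :: "'b \<Rightarrow> 'a"
  assumes hom_additive: "additive h"
    and hom_F: "c \<in> F' 0 \<Longrightarrow> h c \<in> F 0"
    and hom_mult: "c \<in> F' 0 \<Longrightarrow> d \<in> F' 0 \<Longrightarrow> h (m' c d) = m (h c) (h d)"
begin

lemma hom_funpow_mult:
  assumes "c \<in> F' 0" "d \<in> F' 0"
  shows "h ((m' c ^^ j) d) = (m (h c) ^^ j) (h d)"
proof -
  have "(m' c ^^ j) d \<in> F' 0" for j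
    by (induction j) (use assms src.F_mult[of _ 0 _ 0] in auto)
  then show ?thesis by (induction j) (use assms hom_mult in auto)
qed

lemma hom_phi: "c \<in> F' 0 \<Longrightarrow> d \<in> F' 0 \<Longrightarrow> h (src.phi r (m' c) d) = tgt.phi r (m (h c)) (h d)"
  unfolding src.phi_def tgt.phi_def
  by (simp add: additive.sum[OF hom_additive] additive.zmul[OF hom_additive] hom_funpow_mult)

lemma hom_bch:
  assumes "c \<in> F' 0" "d \<in> F' 0"
  shows "h (src.bch c d) = tgt.bch (h c) (h d)"
proof (rule tgt.bch_eqI[symmetric])
  have W: "h (src.W c) = tgt.W (h c)" if "c \<in> F' 0" for c
    using that by (simp add: src.W_def tgt.W_def hom_phi)
  have "src.W d \<in> F' 0" using assms by (simp add: src.W_F_iff)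
  have "tgt.W (h (src.bch c d)) = h (src.W c + src.E c (src.W d))"
    using W[OF src.bch_F[OF assms]] src.W_bch[OF assms] by simp
  also have "\<dots> = tgt.W (h c) + tgt.E (h c) (tgt.W (h d))"
    using assms \<open>src.W d \<in> F' 0\<close> by (simp add: additive.add[OF hom_additive] hom_phi W)
  finally show "tgt.W (h (src.bch c d)) = \<dots>" .
qed (use assms hom_F src.bch_F in auto)

end

section \<open>The derivative of the exponential\<close>

locale filtered_prelie = filtered_algebra k F p n m
  for k and F :: "nat \<Rightarrow> 'a::ab_group_add set" and p n m +
  assumes prelie: "m (m x y) z - m x (m y z) = m (m y x) z - m y (m x z)"
begin

definition ad :: "'a \<Rightarrow> 'a \<Rightarrow> 'a" where
  "ad x y = m x y - m y x"

lemma mult_ad: "m z (m x y) = m (ad z x) y + m x (m z y)"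
  using prelie[of z x y] by (simp add: ad_def mult_left.diff algebra_simps)

sublocale ad: additive "ad z" for z
  by unfold_locales (simp add: ad_def mult_add_left mult_add_right algebra_simps)

lemma filtered_hom_ad: "z \<in> F 0 \<Longrightarrow> filtered_hom 1 (ad z)"
proof (rule filtered_homI)
  show "ad z x \<in> F (i + 1)" if "z \<in> F 0" "x \<in> F i" for i x
    using F_mult[OF F_0_imp_F_1[OF that(1)] that(2)] F_mult[OF that(2) F_0_imp_F_1[OF that(1)]]
    by (simp add: ad_def F_diff)
qed (rule ad.add)

end

locale filtered_prelie_derivation = filtered_prelie k F p n m
  for k and F :: "nat \<Rightarrow> 'a::ab_group_add set" and p n m +
  fixes D :: "'a \<Rightarrow> 'a"
  assumes deriv_add: "D (x + y) = D x + D y"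
    and deriv_mult: "D (m x y) = m (D x) y + m x (D y)"
    and deriv_F: "x \<in> F i \<Longrightarrow> D x \<in> F i"
begin

sublocale deriv: additive D
  by unfold_locales (rule deriv_add)

text \<open>The formula for the left logarithmic derivative \<open>(D e\<^bsup>z\<^esup>) e\<^bsup>-z\<^esup>\<close>.\<close>

definition logder :: "'a \<Rightarrow> 'a" where
  "logder z = phi 1 (ad z) (D z)"

lemma logder_F: "z \<in> F 0 \<Longrightarrow> logder z \<in> F 0"
  unfolding logder_def by (intro phi_F[OF filtered_hom_ad] deriv_F)

lemma logder_eq_zero: "D z = 0 \<Longrightarrow> logder z = 0"
  unfolding logder_def using additive.zero[OF additive_phi[OF ad.additive_axioms]] by simp

lemma logder_eq_self: "D z = z \<Longrightarrow> logder z = z"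
  unfolding logder_def using phi_eq_head[OF ad.additive_axioms, of z z 1] by (simp add: ad_def)

lemma funpow_ad_F: "z \<in> F 0 \<Longrightarrow> (ad z ^^ i) (D z) \<in> F (Suc i)"
  by (rule funpow_F[OF filtered_hom_ad deriv_F])

lemma sum_mult_logder:
  "(\<Sum>i<k. zmul (inv_factorial (Suc i)) (m ((ad z ^^ i) (D z)) w)) = m (logder z) w"
  by (simp add: logder_def phi_def mult_left.sum mult_left.zmul)

lemma deriv_E:
  assumes z: "z \<in> F 0" and x: "x \<in> F 0"
  shows "D (E z x) = m (logder z) (E z x) + E z (D x)"
proof -
  let ?q = "\<lambda>i. (ad z ^^ i) (D z)" and ?y = "\<lambda>l. (m z ^^ l) x"
  define G where "G i l = (case i of 0 \<Rightarrow> D (?y l) | Suc i \<Rightarrow> - m (?q i) (?y l))" for i l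
  have y_F: "?y l \<in> F (Suc l)" for l
    using funpow_F[OF filtered_hom_mult_F_0[OF z] x] .
  have "m z (G i l) = G (Suc i) l + G i (Suc l)" for i l
    by (cases i) (simp_all add: G_def deriv_mult mult_right.minus mult_ad[of z "?q _"])
  moreover have "G i l = 0" if "k \<le> i + l" for i l
  proof (cases i)
    case 0
    then show ?thesis using that F_eq_zero[OF deriv_F[OF y_F]] by (simp add: G_def)
  next
    case (Suc j)
    then show ?thesis using that F_eq_zero[OF F_mult[OF funpow_ad_F[OF z] y_F]] by (simp add: G_def)
  qed
  ultimately have "E z (G 0 0) = (\<Sum>i<Suc k. zmul (inv_factorial i) (\<Sum>l<Suc k. zmul (inv_factorial l) (G i l)))"
    by (intro exp_leibniz mult_right.additive_axioms)
  also have "\<dots> = D (E z x) + (\<Sum>i<k. zmul (inv_factorial (Suc i)) (- m (?q i) (E z x)))"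
    using phi_Suc_k[OF filtered_hom_mult_F_0[OF z] x, of 0]
    by (subst sum.lessThan_Suc_shift)
      (simp add: G_def deriv.sum deriv.zmul mult_right.sum mult_right.zmul sum_negf del: sum.lessThan_Suc)
  finally show ?thesis by (simp add: sum_negf sum_mult_logder G_def)
qed

text \<open>With an identity adjoined, \<open>W z = e\<^bsup>L\<^sub>z\<^esup> 1 - 1\<close>, so this is \<open>deriv_E\<close> for \<open>x = 1\<close>.\<close>

lemma deriv_W:
  assumes z: "z \<in> F 0"
  shows "D (W z) = logder z + m (logder z) (W z)"
proof -
  let ?q = "\<lambda>i. (ad z ^^ i) (D z)" and ?y = "\<lambda>l. (m z ^^ l) z"
  define G where "G i l = (case i of
      0 \<Rightarrow> (case l of 0 \<Rightarrow> 0 | Suc l \<Rightarrow> D (?y l))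
    | Suc i \<Rightarrow> - (case l of 0 \<Rightarrow> ?q i | Suc l \<Rightarrow> m (?q i) (?y l)))" for i l
  have y_F: "?y l \<in> F (Suc l)" for l
    using funpow_F[OF filtered_hom_mult_F_0[OF z] z] .
  have "m z (G i l) = G (Suc i) l + G i (Suc l)" for i l
    by (cases i; cases l)
      (simp_all add: G_def deriv_mult mult_right.minus mult_right.zero mult_ad[of z "?q _"] ad_def)
  moreover have "G i l = 0" if "k \<le> i + l" for i l
  proof -
    have "D (?y l) \<in> F (Suc l)" "?q i \<in> F (Suc i)" "m (?q i) (?y l) \<in> F (Suc i + Suc l)" for i l
      using deriv_F[OF y_F] funpow_ad_F[OF z] F_mult[OF funpow_ad_F[OF z] y_F] by blast+
    from this[THEN F_eq_zero] show ?thesis using that by (auto simp: G_def split: nat.split)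
  qed
  ultimately have "E z (G 0 0) = (\<Sum>i<Suc k. zmul (inv_factorial i) (\<Sum>l<Suc k. zmul (inv_factorial l) (G i l)))"
    by (intro exp_leibniz mult_right.additive_axioms)
  also have "\<dots> = D (W z) +
      (\<Sum>i<k. - (zmul (inv_factorial (Suc i)) (?q i) + zmul (inv_factorial (Suc i)) (m (?q i) (W z))))"
    by (simp only: sum.lessThan_Suc_shift)
      (simp add: G_def W_def phi_def deriv.sum deriv.zmul mult_right.sum mult_right.zmul sum_negf
        zmul.scale_right_diff_distrib)
  also have "\<dots> = D (W z) - (logder z + m (logder z) (W z))"
    by (simp only: sum_negf sum.distrib sum_mult_logder) (simp add: logder_def phi_def)
  finally show ?thesis by (simp add: G_def E.zero)
qed

lemma add_mult_right_inject:
  assumes "w \<in> F 0" "v \<in> F 0" "v' \<in> F 0" "v + m v w = v' + m v' w"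
  shows "v = v'"
proof -
  have "filtered_hom 1 (\<lambda>v. m v w)"
    using F_mult[OF _ F_0_imp_F_1[OF assms(1)]] by (intro filtered_homI mult_add_left) simp
  from near_identity_bij_betw[OF near_identity_add_filtered_hom[OF this]]
  show ?thesis using assms(2-4) by (auto simp: bij_betw_def dest: inj_onD)
qed

lemma logder_bch:
  assumes x: "x \<in> F 0" and y: "y \<in> F 0" "D y = 0"
  shows "logder (bch x y) = logder x"
proof (rule add_mult_right_inject)
  have W_y: "W y \<in> F 0" "D (W y) = 0"
    using y by (simp_all add: W_F_iff deriv_W logder_eq_zero mult_left.zero)
  have "logder (bch x y) + m (logder (bch x y)) (W (bch x y)) = D (W x + E x (W y))"
    using deriv_W[OF bch_F[OF x y(1)]] by (simp add: W_bch x y)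
  also have "\<dots> = logder x + m (logder x) (W (bch x y))"
    by (simp add: deriv_add deriv_W x deriv_E W_y E.zero W_bch y mult_add_right add.assoc)
  finally show "logder (bch x y) + m (logder (bch x y)) (W (bch x y)) = \<dots>" .
qed (simp_all add: W_F_iff bch_F x y logder_F)

lemma deriv_E_bch_diff:
  assumes x: "x \<in> F 0" and y: "y \<in> F 0" "D y = 0" and b: "b \<in> F 0" "D b = 0"
  shows "D (E (bch x y) b - E x (E y b)) = m (logder x) (E (bch x y) b - E x (E y b))"
proof -
  have "D (E (bch x y) b) = m (logder x) (E (bch x y) b)"
    using b by (simp add: deriv_E bch_F logder_bch x y E.zero)
  moreover have "D (E x (E y b)) = m (logder x) (E x (E y b))"
    using b by (simp add: deriv_E E_F x y logder_eq_zero mult_left.zero E.zero)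
  ultimately show ?thesis by (simp add: deriv.diff mult_right.diff)
qed

end

section \<open>Composition of flows\<close>

lemma fps_nth_zmul [simp]: "fps_nth (zmul r c) j = zmul r (fps_nth c j)"
proof -
  have "additive (\<lambda>c. fps_nth c j)" by unfold_locales simp
  from additive.zmul[OF this] show ?thesis .
qed

context filtered_algebra
begin

definition fps_mult :: "'a fps \<Rightarrow> 'a fps \<Rightarrow> 'a fps" where
  "fps_mult c d = Abs_fps (\<lambda>j. \<Sum>i\<le>j. m (fps_nth c i) (fps_nth d (j - i)))"

text \<open>The condition \<open>c\<^sub>j \<in> F j\<close> makes the series finite, so that they can be evaluated at \<open>1\<close>.\<close>

definition fps_F :: "nat \<Rightarrow> 'a fps set" where
  "fps_F i = {c. \<forall>j. fps_nth c j \<in> F (max i j)}"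

definition fps_euler_deriv :: "'a fps \<Rightarrow> 'a fps" where
  "fps_euler_deriv c = Abs_fps (\<lambda>j. zmul (int j) (fps_nth c j))"

definition fps_eval_1 :: "'a fps \<Rightarrow> 'a" where
  "fps_eval_1 c = (\<Sum>j<k. fps_nth c j)"

definition fps_linear :: "'a \<Rightarrow> 'a fps" where
  "fps_linear x = Abs_fps (\<lambda>j. if j = 1 then x else 0)"

lemma fps_F_nth: "c \<in> fps_F i \<Longrightarrow> fps_nth c j \<in> F (max i j)"
  by (simp add: fps_F_def)

lemma fps_F_0_nth: "c \<in> fps_F 0 \<Longrightarrow> fps_nth c j \<in> F j"
  using fps_F_nth[of c 0 j] by simp

lemma fps_linear_F: "x \<in> F 0 \<Longrightarrow> fps_linear x \<in> fps_F 0"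
  by (simp add: fps_linear_def fps_F_def F_zero F_0_imp_F_1)

lemma fps_const_F: "b \<in> F 0 \<Longrightarrow> fps_const b \<in> fps_F 0"
  by (simp add: fps_F_def F_zero)

lemma fps_F_0_subset_fps_F_1: "fps_F 0 \<subseteq> fps_F 1"
proof
  fix c assume "c \<in> fps_F 0"
  then have "fps_nth c j \<in> F (max 1 j)" for j
    using fps_F_0_nth[of c j] F_0_imp_F_1 by (cases j) auto
  then show "c \<in> fps_F 1" by (simp add: fps_F_def)
qed

lemma fps_mult_F:
  assumes "x \<in> fps_F i" "y \<in> fps_F j"
  shows "fps_mult x y \<in> fps_F (i + j)"
proof -
  have "m (fps_nth x a) (fps_nth y (l - a)) \<in> F (max (i + j) l)" if "a \<le> l" for a l
    by (rule F_antimono[OF F_mult[OF fps_F_nth[OF assms(1)] fps_F_nth[OF assms(2)]]]) (use that in auto)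
  then show ?thesis by (auto simp: fps_F_def fps_mult_def intro: F_sum)
qed

lemma fps_filtered_algebra: "filtered_algebra k fps_F p n fps_mult"
proof
  show "zmul (int (p ^ n)) x = 0" for x :: "'a fps"
    by (rule fps_ext) (simp only: fps_nth_zmul torsion fps_zero_nth)
  show "fps_F (Suc i) \<subseteq> fps_F i" for i
    by (auto simp: fps_F_def intro: F_antimono)
  show "a \<in> fps_F k \<Longrightarrow> a = 0" for a
    by (auto simp: fps_F_def intro!: fps_ext F_eq_zero)
qed (use prime_p k_less_p k_ge_2 fps_F_0_subset_fps_F_1 fps_mult_F in
    \<open>auto simp: fps_F_def fps_mult_def F_zero F_diff mult_add_left mult_add_right sum.distrib intro!: fps_ext\<close>)

lemma filtered_algebra_hom_nth_0: "filtered_algebra_hom k fps_F p n fps_mult F m (\<lambda>c. fps_nth c 0)"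
proof -
  interpret fps: filtered_algebra k fps_F p n fps_mult by (rule fps_filtered_algebra)
  show ?thesis
    by unfold_locales (use fps_F_0_nth in \<open>auto simp: fps_mult_def\<close>)
qed

lemma filtered_algebra_hom_eval_1: "filtered_algebra_hom k fps_F p n fps_mult F m fps_eval_1"
proof -
  interpret fps: filtered_algebra k fps_F p n fps_mult by (rule fps_filtered_algebra)
  show ?thesis
  proof
    fix c d assume c: "c \<in> fps_F 0"
    show "fps_eval_1 c \<in> F 0"
      unfolding fps_eval_1_def by (intro F_sum F_antimono[OF fps_F_0_nth[OF c]]) auto
    assume d: "d \<in> fps_F 0"
    have "m (fps_eval_1 c) (fps_eval_1 d) = (\<Sum>i<k. \<Sum>l<k. m (fps_nth c i) (fps_nth d l))"
      by (simp only: fps_eval_1_def mult_left.sum) (simp only: mult_right.sum)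
    also have "\<dots> = fps_eval_1 (fps_mult c d)"
      unfolding fps_eval_1_def fps_mult_def
      by (subst sum_square_eq_triangle)
        (auto intro: F_eq_zero[OF F_mult[OF fps_F_0_nth[OF c] fps_F_0_nth[OF d]]])
    finally show "fps_eval_1 (fps_mult c d) = m (fps_eval_1 c) (fps_eval_1 d)" ..
  qed (simp add: fps_eval_1_def sum.distrib)
qed

lemma fps_eval_1_linear [simp]: "fps_eval_1 (fps_linear x) = x"
  using k_ge_2 by (simp add: fps_eval_1_def fps_linear_def)

lemma fps_eval_1_const [simp]: "fps_eval_1 (fps_const b) = b"
  using k_ge_2 by (simp add: fps_eval_1_def)

lemma fps_euler_deriv_mult:
  "fps_euler_deriv (fps_mult x y) = fps_mult (fps_euler_deriv x) y + fps_mult x (fps_euler_deriv y)"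
proof (rule fps_ext)
  fix j
  let ?t = "\<lambda>i. m (fps_nth x i) (fps_nth y (j - i))"
  have "(\<Sum>i\<le>j. zmul (int j) (?t i)) = (\<Sum>i\<le>j. zmul (int i) (?t i) + zmul (int (j - i)) (?t i))"
    by (intro sum.cong refl) (simp add: zmul_add_left[symmetric] of_nat_diff)
  then show "fps_nth (fps_euler_deriv (fps_mult x y)) j =
      fps_nth (fps_mult (fps_euler_deriv x) y + fps_mult x (fps_euler_deriv y)) j"
    by (simp add: fps_euler_deriv_def fps_mult_def zmul.scale_sum_right mult_left.zmul mult_right.zmul
        sum.distrib)
qed

lemma fps_nth_associator:
  "fps_nth (fps_mult (fps_mult x y) z - fps_mult x (fps_mult y z)) j =
    (\<Sum>l\<le>j. \<Sum>i\<le>l. m (m (fps_nth x i) (fps_nth y (l - i))) (fps_nth z (j - l)) -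
      m (fps_nth x i) (m (fps_nth y (l - i)) (fps_nth z (j - l))))"
  using fps_mult_assoc_lemma[of "\<lambda>a b c. m (fps_nth x a) (m (fps_nth y b) (fps_nth z c))" j j]
  by (simp add: fps_mult_def mult_left.sum mult_right.sum sum_subtractf atMost_atLeast0)

lemma fps_linear_ode_unique:
  assumes d: "d \<in> fps_F 0" "fps_nth d 0 = 0" and ode: "fps_euler_deriv d = fps_mult (fps_linear x) d"
  shows "d = 0"
proof (rule fps_ext)
  have rec: "zmul (int (Suc j)) (fps_nth d (Suc j)) = m x (fps_nth d j)" for j
  proof -
    have "fps_nth (fps_mult (fps_linear x) d) (Suc j) = (\<Sum>i\<le>Suc j. if i = 1 then m x (fps_nth d j) else 0)"
      unfolding fps_mult_def fps_nth_Abs_fps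
      by (intro sum.cong refl) (auto simp: fps_linear_def mult_left.zero)
    also have "\<dots> = m x (fps_nth d j)" by (subst sum.delta) auto
    finally show ?thesis using ode by (metis fps_euler_deriv_def fps_nth_Abs_fps)
  qed
  fix j show "fps_nth d j = fps_nth 0 j"
  proof (induction j)
    case 0
    then show ?case by (simp add: d)
  next
    case (Suc j)
    show ?case
    proof (cases "Suc j < k")
      case True
      then have "Suc j < p" using k_less_p by simp
      then show ?thesis
        using zmul_nat_cancel[of "Suc j" "fps_nth d (Suc j)" 0] rec[of j] Suc by (simp add: mult_right.zero)
    next
      case False
      then show ?thesis using F_eq_zero[OF fps_F_0_nth[OF d(1)]] by simp
    qed
  qed
qed

end

context filtered_prelie
begin

lemma fps_prelie:
  "fps_mult (fps_mult x y) z - fps_mult x (fps_mult y z) =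
    fps_mult (fps_mult y x) z - fps_mult y (fps_mult x z)"
proof (rule fps_ext)
  fix j
  let ?A = "\<lambda>x y z. m (m x y) z - m x (m y z)"
  have "(\<Sum>i\<le>l. ?A (fps_nth x i) (fps_nth y (l - i)) c) = (\<Sum>i\<le>l. ?A (fps_nth y i) (fps_nth x (l - i)) c)" for l c
    by (rule sum.reindex_bij_witness[of _ "\<lambda>i. l - i" "\<lambda>i. l - i"]) (auto simp: prelie)
  then show "fps_nth (fps_mult (fps_mult x y) z - fps_mult x (fps_mult y z)) j =
      fps_nth (fps_mult (fps_mult y x) z - fps_mult y (fps_mult x z)) j"
    unfolding fps_nth_associator by simp
qed

lemma fps_prelie_derivation: "filtered_prelie_derivation k fps_F p n fps_mult fps_euler_deriv"
proof -
  interpret fps: filtered_algebra k fps_F p n fps_mult by (rule fps_filtered_algebra)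
  show ?thesis
  proof
    show "fps_euler_deriv (x + y) = fps_euler_deriv x + fps_euler_deriv y" for x y
      by (rule fps_ext) (simp add: fps_euler_deriv_def zmul.scale_right_distrib)
    show "x \<in> fps_F i \<Longrightarrow> fps_euler_deriv x \<in> fps_F i" for x i
      by (auto simp: fps_F_def fps_euler_deriv_def intro: F_zmul)
  qed (fact fps_prelie fps_euler_deriv_mult)+
qed

interpretation fps: filtered_prelie_derivation k fps_F p n fps_mult fps_euler_deriv
  by (rule fps_prelie_derivation)

interpretation eval_1: filtered_algebra_hom k fps_F p n fps_mult F m fps_eval_1
  by (rule filtered_algebra_hom_eval_1)

interpretation nth_0: filtered_algebra_hom k fps_F p n fps_mult F m "\<lambda>c. fps_nth c 0"
  by (rule filtered_algebra_hom_nth_0)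

text \<open>Replace \<open>x\<close> by \<open>t x\<close>: both sides then solve the same linear differential equation in \<open>t\<close>.\<close>

lemma fps_E_bch:
  assumes x: "x \<in> F 0" and y: "y \<in> F 0" and b: "b \<in> F 0"
  defines "X \<equiv> fps_linear x" and "Y \<equiv> fps_const y"
  shows "fps.E (fps.bch X Y) (fps_const b) = fps.E X (fps.E Y (fps_const b))"
proof -
  let ?b = "fps_const b" and ?Z = "fps.bch X Y"
  have X: "X \<in> fps_F 0" "fps_euler_deriv X = X" "fps_nth X 0 = 0"
    using x by (simp_all add: X_def fps_linear_F, auto simp: fps_linear_def fps_euler_deriv_def intro!: fps_ext)
  have const: "fps_const c \<in> fps_F 0" "fps_euler_deriv (fps_const c) = 0" if "c \<in> F 0" for c
    using that by (simp add: fps_const_F, auto simp: fps_euler_deriv_def intro!: fps_ext)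
  note Y = const[OF y, folded Y_def] and b = const[OF b]
  note E_F = fps.E_F[OF fps.bch_F[OF X(1) Y(1)] b(1)] fps.E_F[OF Y(1) b(1)]
    fps.E_F[OF X(1) fps.E_F[OF Y(1) b(1)]]
  define d where "d = fps.E ?Z ?b - fps.E X (fps.E Y ?b)"
  have "d = 0"
  proof (rule fps_linear_ode_unique)
    show "d \<in> fps_F 0" unfolding d_def by (intro fps.F_diff E_F)
    have "fps_nth d 0 = E (bch 0 y) b - E 0 (E y b)"
      using X(3) by (simp add: d_def nth_0.hom_phi nth_0.hom_bch fps.bch_F X(1) Y b E_F) (simp add: Y_def)
    then show "fps_nth d 0 = 0" by (simp add: bch_0_left y)
    show "fps_euler_deriv d = fps_mult (fps_linear x) d"
      using fps.deriv_E_bch_diff[OF X(1) Y b] fps.logder_eq_self[OF X(2)] by (simp add: d_def X_def)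
  qed
  then show ?thesis by (simp add: d_def)
qed

lemma E_bch:
  assumes "x \<in> F 0" "y \<in> F 0" "b \<in> F 0"
  shows "E (bch x y) b = E x (E y b)"
proof -
  note [simp] = fps_linear_F[OF assms(1)] fps_const_F[OF assms(2)] fps_const_F[OF assms(3)]
    fps.bch_F fps.E_F
  have "fps_eval_1 (fps.E (fps.bch (fps_linear x) (fps_const y)) (fps_const b)) =
      fps_eval_1 (fps.E (fps_linear x) (fps.E (fps_const y) (fps_const b)))"
    by (simp only: fps_E_bch[OF assms])
  then show ?thesis by (simp add: eval_1.hom_phi eval_1.hom_bch)
qed

end

section \<open>Polynomial maps into a filtered group\<close>

context filtration
begin

coinductive polymap :: "nat \<Rightarrow> ('m::plus \<Rightarrow> 'a) \<Rightarrow> bool" where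
  polymapI: "(\<And>x. \<phi> x \<in> F s) \<Longrightarrow> (\<And>h. polymap (Suc s) (forward_diff h \<phi>)) \<Longrightarrow> polymap s \<phi>"

lemma polymap_F: "polymap s \<phi> \<Longrightarrow> \<phi> x \<in> F s"
  by (auto elim: polymap.cases)

lemma polymap_forward_diff: "polymap s \<phi> \<Longrightarrow> polymap (Suc s) (forward_diff h \<phi>)"
  by (auto elim: polymap.cases)

lemma polymap_coinduct:
  assumes "P s \<phi>" and "\<And>s \<phi> x. P s \<phi> \<Longrightarrow> \<phi> x \<in> F s"
    and "\<And>s \<phi> h. P s \<phi> \<Longrightarrow> P (Suc s) (forward_diff h \<phi>)"
  shows "polymap s \<phi>"
  using assms(1) by (rule polymap.coinduct[of P]) (use assms(2,3) in blast)

lemma polymap_funpow_forward_diff: "polymap s \<phi> \<Longrightarrow> polymap (s + l) ((forward_diff h ^^ l) \<phi>)"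
  by (induction l) (auto intro: polymap_forward_diff)

lemma polymap_const:
  assumes "b \<in> F s"
  shows "polymap s (\<lambda>x::'m::plus. b)"
proof (rule polymap_coinduct[where P = "\<lambda>s \<phi>. \<exists>b\<in>F s. \<phi> = (\<lambda>x. b)"])
  fix s and \<phi> :: "'m \<Rightarrow> 'a" and h
  assume "\<exists>b\<in>F s. \<phi> = (\<lambda>x. b)"
  then have "forward_diff h \<phi> = (\<lambda>x. 0)" by (auto simp: forward_diff_def)
  then show "\<exists>b\<in>F (Suc s). forward_diff h \<phi> = (\<lambda>x. b)" using F_zero by blast
qed (use assms in auto)

lemma polymap_antimono:
  fixes \<phi> :: "'m::plus \<Rightarrow> 'a"
  assumes "polymap s \<phi>" "s' \<le> s"
  shows "polymap s' \<phi>"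
proof (rule polymap_coinduct[where P = "\<lambda>s' \<phi>. \<exists>s\<ge>s'. polymap s \<phi>"])
  fix s' and \<phi> :: "'m \<Rightarrow> 'a" and h
  assume "\<exists>s\<ge>s'. polymap s \<phi>"
  then show "\<exists>s\<ge>Suc s'. polymap s (forward_diff h \<phi>)"
    using polymap_forward_diff Suc_le_mono by blast
qed (use assms in \<open>auto intro: F_antimono polymap_F\<close>)

lemma polymap_add:
  fixes \<phi> :: "'m::plus \<Rightarrow> 'a"
  assumes "polymap s \<phi>" "polymap s \<psi>"
  shows "polymap s (\<lambda>x. \<phi> x + \<psi> x)"
proof (rule polymap_coinduct[where P = "\<lambda>s \<chi>. \<exists>\<phi> \<psi>. polymap s \<phi> \<and> polymap s \<psi> \<and> \<chi> = (\<lambda>x. \<phi> x + \<psi> x)"])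
  fix s and \<chi> :: "'m \<Rightarrow> 'a" and h
  assume "\<exists>\<phi> \<psi>. polymap s \<phi> \<and> polymap s \<psi> \<and> \<chi> = (\<lambda>x. \<phi> x + \<psi> x)"
  then obtain \<phi> \<psi> where "polymap s \<phi>" "polymap s \<psi>" and \<chi>: "\<chi> = (\<lambda>x. \<phi> x + \<psi> x)" by blast
  moreover have "forward_diff h \<chi> = (\<lambda>x. forward_diff h \<phi> x + forward_diff h \<psi> x)"
    by (auto simp: \<chi> forward_diff_def)
  ultimately show "\<exists>\<phi> \<psi>. polymap (Suc s) \<phi> \<and> polymap (Suc s) \<psi> \<and> forward_diff h \<chi> = (\<lambda>x. \<phi> x + \<psi> x)"
    using polymap_forward_diff by blast
qed (use assms in \<open>auto intro: F_add polymap_F\<close>)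

lemma polymap_sum: "(\<And>i. i \<in> S \<Longrightarrow> polymap s (\<phi> i)) \<Longrightarrow> polymap s (\<lambda>x. \<Sum>i\<in>S. \<phi> i x)"
  by (induction S rule: infinite_finite_induct) (auto intro: polymap_add polymap_const[OF F_zero])

lemma polymap_shift:
  assumes "polymap s \<phi>"
  shows "polymap s (\<lambda>x. \<phi> (x + h))"
proof -
  have "polymap s (forward_diff h \<phi>)"
    using polymap_antimono[OF polymap_forward_diff[OF assms]] by simp
  from polymap_add[OF assms this] show ?thesis by (simp add: forward_diff_def)
qed

lemma polymap_filtered_hom:
  fixes \<phi> :: "'m::plus \<Rightarrow> 'a"
  assumes "filtered_hom d f" "polymap s \<phi>"
  shows "polymap (s + d) (\<lambda>x. f (\<phi> x))"
proof (rule polymap_coinduct[where P = "\<lambda>r \<chi>. \<exists>s \<phi>. r = s + d \<and> polymap s \<phi> \<and> \<chi> = (\<lambda>x. f (\<phi> x))"])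
  interpret additive f using assms(1) by (rule filtered_hom_additive)
  fix r and \<chi> :: "'m \<Rightarrow> 'a" and h
  assume "\<exists>s \<phi>. r = s + d \<and> polymap s \<phi> \<and> \<chi> = (\<lambda>x. f (\<phi> x))"
  then obtain s \<phi> where "r = s + d" "polymap s \<phi>" and \<chi>: "\<chi> = (\<lambda>x. f (\<phi> x))" by blast
  moreover have "forward_diff h \<chi> = (\<lambda>x. f (forward_diff h \<phi> x))"
    by (auto simp: \<chi> forward_diff_def diff)
  ultimately show "\<exists>s \<phi>. Suc r = s + d \<and> polymap s \<phi> \<and> forward_diff h \<chi> = (\<lambda>x. f (\<phi> x))"
    using polymap_forward_diff by (metis add_Suc)
qed (use assms in \<open>auto intro: filtered_hom_F polymap_F\<close>)

lemma polymap_zmul: "polymap s \<phi> \<Longrightarrow> polymap s (\<lambda>x. zmul r (\<phi> x))"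
  using polymap_filtered_hom[OF filtered_hom_zmul] by simp

lemma polymap_comp_hom:
  assumes "\<And>x y. g (x + y) = g x + g y" "polymap s \<phi>"
  shows "polymap s (\<lambda>x. \<phi> (g x))"
proof (rule polymap_coinduct[where P = "\<lambda>s \<chi>. \<exists>\<phi>. polymap s \<phi> \<and> \<chi> = (\<lambda>x. \<phi> (g x))"])
  fix s \<chi> h
  assume "\<exists>\<phi>. polymap s \<phi> \<and> \<chi> = (\<lambda>x. \<phi> (g x))"
  then obtain \<phi> where "polymap s \<phi>" and \<chi>: "\<chi> = (\<lambda>x. \<phi> (g x))" by blast
  moreover have "forward_diff h \<chi> = (\<lambda>x. forward_diff (g h) \<phi> (g x))"
    by (auto simp: \<chi> forward_diff_def assms(1))
  ultimately show "\<exists>\<phi>. polymap (Suc s) \<phi> \<and> forward_diff h \<chi> = (\<lambda>x. \<phi> (g x))"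
    using polymap_forward_diff by blast
qed (use assms in \<open>auto intro: polymap_F\<close>)

lemma polymap_zmul_hom:
  assumes \<theta>: "\<And>x y. \<theta> (x + y) = \<theta> x + \<theta> y" and \<phi>: "polymap (Suc s) \<phi>"
  shows "polymap s (\<lambda>x. zmul (\<theta> x) (\<phi> x))"
proof (rule polymap_coinduct[where
      P = "\<lambda>s \<chi>. \<exists>\<phi> \<psi>. polymap (Suc s) \<phi> \<and> polymap s \<psi> \<and> \<chi> = (\<lambda>x. zmul (\<theta> x) (\<phi> x) + \<psi> x)"])
  show "\<exists>\<phi>' \<psi>. polymap (Suc s) \<phi>' \<and> polymap s \<psi> \<and> (\<lambda>x. zmul (\<theta> x) (\<phi> x)) = (\<lambda>x. zmul (\<theta> x) (\<phi>' x) + \<psi> x)"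
    using \<phi> polymap_const[OF F_zero] by (intro exI[of _ \<phi>] exI[of _ "\<lambda>x. 0"]) simp
  fix s \<chi>
  assume "\<exists>\<phi> \<psi>. polymap (Suc s) \<phi> \<and> polymap s \<psi> \<and> \<chi> = (\<lambda>x. zmul (\<theta> x) (\<phi> x) + \<psi> x)"
  then obtain \<phi> \<psi> where \<phi>: "polymap (Suc s) \<phi>" and \<psi>: "polymap s \<psi>"
    and \<chi>: "\<chi> = (\<lambda>x. zmul (\<theta> x) (\<phi> x) + \<psi> x)" by blast
  show "\<chi> x \<in> F s" for x
    using polymap_F[OF \<phi>, of x] polymap_F[OF \<psi>, of x] F_Suc unfolding \<chi> by (blast intro: F_add F_zmul)
  fix h
  have "forward_diff h \<chi> =
      (\<lambda>x. zmul (\<theta> x) (forward_diff h \<phi> x) + (zmul (\<theta> h) (\<phi> (x + h)) + forward_diff h \<psi> x))"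
    by (auto simp: \<chi> forward_diff_def \<theta> zmul_add_left zmul.scale_right_diff_distrib algebra_simps)
  moreover have "polymap (Suc s) (\<lambda>x. zmul (\<theta> h) (\<phi> (x + h)) + forward_diff h \<psi> x)"
    by (intro polymap_add polymap_zmul polymap_shift polymap_forward_diff \<phi> \<psi>)
  ultimately show "\<exists>\<phi> \<psi>. polymap (Suc (Suc s)) \<phi> \<and> polymap (Suc s) \<psi> \<and>
      forward_diff h \<chi> = (\<lambda>x. zmul (\<theta> x) (\<phi> x) + \<psi> x)"
    using polymap_forward_diff[OF \<phi>] by blast
qed

lemma polymap_zmul_power:
  fixes \<phi> :: "nat \<Rightarrow> 'a"
  shows "polymap (s + i) \<phi> \<Longrightarrow> polymap s (\<lambda>t. zmul (int t ^ i) (\<phi> t))"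
proof (induction i arbitrary: s)
  case 0
  then show ?case by simp
next
  case (Suc i)
  from Suc.IH[of "Suc s"] Suc.prems have "polymap (Suc s) (\<lambda>t. zmul (int t ^ i) (\<phi> t))" by simp
  from polymap_zmul_hom[OF _ this, of int] show ?case by simp
qed

definition eval_poly :: "(nat \<Rightarrow> 'a) \<Rightarrow> nat \<Rightarrow> 'a" where
  "eval_poly c t = (\<Sum>j<k. zmul (int t ^ j) (c j))"

lemma polymap_eval_poly: "(\<And>j. c j \<in> F (s + j)) \<Longrightarrow> polymap s (eval_poly c)"
  unfolding eval_poly_def by (intro polymap_sum polymap_zmul_power polymap_const)

lemma eval_poly_0: "eval_poly c 0 = c 0"
  unfolding eval_poly_def lessThan_k_eq by (simp add: power_0_left)

end

context torsion_filtration
begin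

definition taylor_coeff :: "'m::plus \<Rightarrow> ('m \<Rightarrow> 'a) \<Rightarrow> nat \<Rightarrow> 'm \<Rightarrow> 'a" where
  "taylor_coeff h \<phi> j x =
    (\<Sum>l\<in>{j..<k}. zmul (inv_factorial l * signed_stirling l j) ((forward_diff h ^^ l) \<phi> x))"

lemma polymap_taylor_coeff:
  assumes "polymap s \<phi>"
  shows "polymap (s + j) (taylor_coeff h \<phi> j)"
  unfolding taylor_coeff_def
proof (intro polymap_sum polymap_zmul)
  fix l assume "l \<in> {j..<k}"
  then show "polymap (s + j) ((forward_diff h ^^ l) \<phi>)"
    by (intro polymap_antimono[OF polymap_funpow_forward_diff[OF assms, of l]]) simp
qed

lemma zmul_binomial_eq_sum_power:
  assumes "l < k"
  shows "zmul (int (t choose l)) (b::'a) =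
    (\<Sum>j<k. zmul (int t ^ j) (if j \<le> l then zmul (inv_factorial l * signed_stirling l j) b else 0))"
proof -
  have "zmul (int (t choose l)) b = zmul (int (fact l) * inv_factorial l) (zmul (int (t choose l)) b)"
    using assms k_less_p by (simp only: zmul_fact_inv_factorial less_trans)
  also have "\<dots> = zmul (inv_factorial l * (\<Sum>j\<le>l. signed_stirling l j * int t ^ j)) b"
    unfolding sum_signed_stirling_power by (simp add: algebra_simps)
  also have "\<dots> = (\<Sum>j\<le>l. zmul (int t ^ j) (zmul (inv_factorial l * signed_stirling l j) b))"
    by (simp add: sum_distrib_left zmul.scale_sum_left algebra_simps)
  also have "\<dots> = (\<Sum>j<k. zmul (int t ^ j) (if j \<le> l then zmul (inv_factorial l * signed_stirling l j) b else 0))"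
    using assms by (intro sum.mono_neutral_cong_left) auto
  finally show ?thesis .
qed

lemma taylor_expansion:
  assumes "polymap s \<phi>"
  shows "\<phi> (((\<lambda>y. y + h) ^^ t) x) = eval_poly (\<lambda>j. taylor_coeff h \<phi> j x) t"
proof -
  let ?d = "\<lambda>l. (forward_diff h ^^ l) \<phi> x"
  have "?d l = 0" if "k \<le> l" for l
    using F_eq_zero[OF polymap_F[OF polymap_funpow_forward_diff[OF assms]]] that by simp
  then have "\<phi> (((\<lambda>y. y + h) ^^ t) x) = (\<Sum>l<k. zmul (int (t choose l)) (?d l))"
    unfolding newton_forward_difference by (intro sum.mono_neutral_cong) (auto simp: binomial_eq_0)
  also have "\<dots> = (\<Sum>j<k. \<Sum>l<k.
      zmul (int t ^ j) (if j \<le> l then zmul (inv_factorial l * signed_stirling l j) (?d l) else 0))"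
    by (subst sum.swap) (intro sum.cong refl zmul_binomial_eq_sum_power, simp)
  also have "\<dots> = eval_poly (\<lambda>j. taylor_coeff h \<phi> j x) t"
    unfolding eval_poly_def taylor_coeff_def zmul.scale_sum_right[symmetric]
    by (intro sum.cong refl arg_cong[of _ _ "zmul _"] sum.mono_neutral_cong_right) auto
  finally show ?thesis .
qed

lemma polymap_nat_eq_eval_poly:
  fixes \<phi> :: "nat \<Rightarrow> 'a"
  assumes "polymap s \<phi>"
  obtains c where "\<And>j. c j \<in> F (s + j)" "\<phi> = eval_poly c"
proof
  show "taylor_coeff 1 \<phi> j 0 \<in> F (s + j)" for j
    by (rule polymap_F[OF polymap_taylor_coeff[OF assms]])
  have "((\<lambda>y. y + 1) ^^ t) 0 = t" for t :: nat by (induction t) auto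
  then show "\<phi> = eval_poly (\<lambda>j. taylor_coeff 1 \<phi> j 0)"
    using taylor_expansion[OF assms, where h = 1 and x = 0] by (metis ext)
qed

end

section \<open>Extraction of coefficients\<close>

lemma cong_1_imp_power_cong_1:
  fixes x :: int
  assumes "[x = 1] (mod int p)"
  shows "[x ^ (p ^ r) = 1] (mod int p ^ Suc r)"
proof (induction r)
  case 0
  then show ?case using assms by simp
next
  case (Suc r)
  let ?y = "x ^ (p ^ r)"
  have "int p dvd int p ^ Suc r" by simp
  with Suc have "[?y = 1] (mod int p)" by (rule cong_dvd_modulus)
  then have "[?y ^ i = 1 ^ i] (mod int p)" for i by (rule cong_pow)
  then have "[(\<Sum>i<p. ?y ^ i) = (\<Sum>i<p. 1)] (mod int p)" by (intro cong_sum) simp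
  from cong_dvd_iff[OF this] have "int p dvd (\<Sum>i<p. ?y ^ i)" by simp
  moreover have "int p ^ Suc r dvd ?y - 1" using Suc by (simp add: cong_iff_dvd_diff)
  ultimately have "int p ^ Suc r * int p dvd (?y - 1) * (\<Sum>i<p. ?y ^ i)" by (rule mult_dvd_mono[rotated])
  then show ?case
    unfolding power_diff_1_eq[symmetric]
    by (simp add: cong_iff_dvd_diff power_mult[symmetric] mult.commute)
qed

lemma residue_primroot_prime_power_cong_1_iff:
  fixes p \<gamma> :: nat
  assumes p: "prime p" and \<gamma>: "residue_primroot (p ^ Suc r) \<gamma>" and q: "0 < q" "q \<le> Suc r"
  shows "[int (\<gamma> ^ (p ^ r)) ^ d = 1] (mod int p ^ q) \<longleftrightarrow> (p - 1) dvd d"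
proof -
  let ?x = "int (\<gamma> ^ (p ^ r))"
  have ord: "ord (p ^ Suc r) \<gamma> = p ^ r * (p - 1)"
    using \<gamma> totient_prime_power[OF p, of "Suc r"] by (simp add: residue_primroot_def del: power_Suc)
  have top: "[?x ^ e = 1] (mod int p ^ Suc r) \<longleftrightarrow> (p - 1) dvd e" for e
  proof -
    have "[?x ^ e = 1] (mod int p ^ Suc r) \<longleftrightarrow> [\<gamma> ^ (p ^ r * e) = 1] (mod p ^ Suc r)"
      using cong_int_iff[of "\<gamma> ^ (p ^ r * e)" 1 "p ^ Suc r"] by (simp add: power_mult)
    also have "\<dots> \<longleftrightarrow> p ^ r * (p - 1) dvd p ^ r * e"
      by (simp only: ord_divides ord)
    finally show ?thesis using prime_gt_0_nat[OF p] by simp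
  qed
  show ?thesis
  proof
    assume "[?x ^ d = 1] (mod int p ^ q)"
    moreover have "int p dvd int p ^ q" using q by simp
    ultimately have "[?x ^ d = 1] (mod int p)" by (rule cong_dvd_modulus)
    from cong_1_imp_power_cong_1[OF this, of r] have "(p - 1) dvd d * p ^ r"
      by (simp only: power_mult[symmetric] top)
    moreover have "coprime (p - 1) (p ^ r)"
      using coprime_diff_one_left_nat[OF prime_gt_0_nat[OF p]] by simp
    ultimately show "(p - 1) dvd d" by (simp add: coprime_dvd_mult_left_iff)
  next
    assume "(p - 1) dvd d"
    then have "[?x ^ d = 1] (mod int p ^ Suc r)" by (simp only: top)
    moreover have "int p ^ q dvd int p ^ Suc r" using q by (intro le_imp_power_dvd)
    ultimately show "[?x ^ d = 1] (mod int p ^ q)" by (rule cong_dvd_modulus)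
  qed
qed

lemma sum_powers_root_of_unity_cong:
  fixes p \<gamma> :: nat
  assumes p: "prime p" and \<gamma>: "residue_primroot (p ^ Suc r) \<gamma>" and q: "q \<le> Suc r"
  shows "[(\<Sum>i<p - 1. (int (\<gamma> ^ (p ^ r)) ^ d) ^ i) = (if (p - 1) dvd d then int (p - 1) else 0)] (mod int p ^ q)"
proof (cases "q = 0 \<or> (p - 1) dvd d")
  case False
  let ?y = "int (\<gamma> ^ (p ^ r)) ^ d"
  note cong_1_iff = residue_primroot_prime_power_cong_1_iff[OF p \<gamma>]
  have "\<not> int p dvd ?y - 1"
    using False cong_1_iff[of 1 d] by (simp add: cong_iff_dvd_diff)
  then have "coprime (int p ^ q) (?y - 1)"
    using p by (simp add: prime_imp_coprime)
  moreover have "[?y ^ (p - 1) = 1] (mod int p ^ q)"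
    using False q cong_1_iff[of q "d * (p - 1)"] by (simp add: power_mult)
  then have "int p ^ q dvd (?y - 1) * (\<Sum>i<p - 1. ?y ^ i)"
    by (simp add: power_diff_1_eq[symmetric] cong_iff_dvd_diff)
  ultimately show ?thesis
    using False by (simp add: cong_0_iff coprime_dvd_mult_right_iff)
next
  case True
  then show ?thesis
  proof
    assume d: "(p - 1) dvd d"
    have "[(int (\<gamma> ^ (p ^ r)) ^ d) ^ i = 1] (mod int p ^ q)" for i
      using d q residue_primroot_prime_power_cong_1_iff[OF p \<gamma>, of q "d * i"]
      by (cases "q = 0") (simp_all add: power_mult)
    then have "[(\<Sum>i<p - 1. (int (\<gamma> ^ (p ^ r)) ^ d) ^ i) = (\<Sum>i<p - 1. 1)] (mod int p ^ q)"
      by (intro cong_sum)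
    then show ?thesis using d by simp
  qed simp
qed

lemma dvd_pred_mult_add_iff:
  fixes j e N :: nat
  assumes "j < N" "e < N"
  shows "N dvd (N - 1) * e + j \<longleftrightarrow> j = e"
proof -
  have "(N - 1) * e + j + e = N * e + j" using assms by (cases N) auto
  moreover have "[N * e + j = j] (mod N)" by (simp add: cong_def)
  ultimately have "[(N - 1) * e + j + e = j] (mod N)" by (simp only:)
  moreover have "N dvd (N - 1) * e + j \<longleftrightarrow> [(N - 1) * e + j + e = 0 + e] (mod N)"
    by (simp only: cong_add_rcancel_nat cong_0_iff)
  ultimately have "N dvd (N - 1) * e + j \<longleftrightarrow> [j = e] (mod N)"
    by (simp add: cong_def)
  then show ?thesis using cong_less_modulus_unique_nat[of j e N] assms by auto
qed

lemma sum_powers_root_of_unity_orthogonal: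
  fixes p \<gamma> :: nat
  assumes p: "prime p" and \<gamma>: "residue_primroot (p ^ Suc r) \<gamma>" and q: "q \<le> Suc r" and "j < p - 1" "e < p - 1"
  defines "x \<equiv> int (\<gamma> ^ (p ^ r))"
  shows "[(\<Sum>i<p - 1. x ^ ((p - 1 - i) * e + i * j)) = (if j = e then int (p - 1) else 0)] (mod int p ^ q)"
proof -
  let ?d = "(p - 2) * e + j"
  obtain N where p_eq: "p = Suc (Suc N)"
    using prime_ge_2_nat[OF p] by (metis Suc_1 Suc_le_D add_2_eq_Suc le_iff_add)
  have x: "[x ^ ((p - 1) * i) = 1] (mod int p ^ q)" for i
    using q residue_primroot_prime_power_cong_1_iff[OF p \<gamma>, of q "(p - 1) * i"]
    by (cases "q = 0") (simp_all add: x_def)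
  have absorb: "[z * x ^ ((p - 1) * i) = z] (mod int p ^ q)" for z i
    using cong_scalar_left[OF x, of z i] by (simp only: mult_1_right)
  have "[x ^ ((p - 1 - i) * e + i * j) = (x ^ ?d) ^ i] (mod int p ^ q)" if "i < p - 1" for i
  proof -
    have "(p - 1 - i) * e + i * j + (p - 1) * (e * i) = ?d * i + (p - 1) * e"
    proof -
      have shift: "(p - 1 - i) * e + i * e = (p - 1) * e"
        using that by (simp add: add_mult_distrib[symmetric])
      have "(p - 2) * e * i + i * e = (p - 1) * (e * i)" by (simp add: p_eq)
      then have "(p - 1 - i) * e + i * j + (p - 1) * (e * i) =
          (p - 2) * e * i + i * j + ((p - 1 - i) * e + i * e)"
        by presburger
      then show ?thesis unfolding shift by (simp only: add_mult_distrib add_mult_distrib2 ac_simps)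
    qed
    then have "x ^ ((p - 1 - i) * e + i * j) * x ^ ((p - 1) * (e * i)) = (x ^ ?d) ^ i * x ^ ((p - 1) * e)"
      by (simp only: power_add[symmetric] power_mult[symmetric])
    then have "[x ^ ((p - 1 - i) * e + i * j) = (x ^ ?d) ^ i * x ^ ((p - 1) * e)] (mod int p ^ q)"
      using cong_sym[OF absorb[of "x ^ ((p - 1 - i) * e + i * j)" "e * i"]] by (simp only:)
    then show ?thesis using absorb by (rule cong_trans)
  qed
  then have "[(\<Sum>i<p - 1. x ^ ((p - 1 - i) * e + i * j)) = (\<Sum>i<p - 1. (x ^ ?d) ^ i)] (mod int p ^ q)"
    by (intro cong_sum) simp
  moreover have "(p - 1) dvd ?d \<longleftrightarrow> j = e"
    using dvd_pred_mult_add_iff[OF assms(4,5)] by (simp add: p_eq)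
  ultimately show ?thesis
    using sum_powers_root_of_unity_cong[OF p \<gamma> q, of ?d, folded x_def] by (auto intro: cong_trans)
qed

locale primroot_filtration = torsion_filtration k F p n
  for k and F :: "nat \<Rightarrow> 'a::ab_group_add set" and p n +
  fixes \<gamma> :: nat
  assumes primroot: "residue_primroot (p ^ p) \<gamma>" and n_le_p: "n \<le> p" and F_0: "F 0 = UNIV"
begin

lemma F_1: "F (Suc 0) = UNIV"
  using F_0_imp_F_1 F_0 by blast

abbreviation \<xi> :: nat where "\<xi> \<equiv> \<gamma> ^ (p ^ (p - 1))"

text \<open>For \<open>e = 1\<close> this is the operator occurring in the associated pre-Lie product.  It reads off
  the coefficient of \<open>t ^ e\<close> because \<open>\<xi>\<close> has order \<open>p - 1\<close> modulo every power of \<open>p\<close> up to \<open>p ^ p\<close>, and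
  \<open>(1 + p + \<dots> + p ^ (n - 1)) (p - 1) = p ^ n - 1\<close>.\<close>

definition coef :: "nat \<Rightarrow> (nat \<Rightarrow> 'a) \<Rightarrow> 'a" where
  "coef e \<phi> = zmul (- int (\<Sum>i<n. p ^ i)) (\<Sum>i<p - 1. zmul (int (\<xi> ^ ((p - 1 - i) * e))) (\<phi> (\<xi> ^ i)))"

abbreviation deriv_at_0 :: "(nat \<Rightarrow> 'a) \<Rightarrow> 'a" where
  "deriv_at_0 \<equiv> coef (Suc 0)"

lemma coef_add: "coef e (\<lambda>t. \<phi> t + \<psi> t) = coef e \<phi> + coef e \<psi>"
  by (simp add: coef_def zmul.scale_right_distrib sum.distrib)

lemma coef_zero: "coef e (\<lambda>t. 0) = 0"
  by (simp add: coef_def)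

lemma coef_sum: "coef e (\<lambda>t. \<Sum>i\<in>S. \<phi> i t) = (\<Sum>i\<in>S. coef e (\<phi> i))"
  by (induction S rule: infinite_finite_induct) (simp_all add: coef_add coef_zero)

lemma coef_additive: "additive f \<Longrightarrow> coef e (\<lambda>t. f (\<phi> t)) = f (coef e \<phi>)"
  by (simp only: coef_def additive.zmul additive.sum)

lemma coef_swap: "coef e (\<lambda>s. coef d (\<lambda>t. \<phi> s t)) = coef d (\<lambda>t. coef e (\<lambda>s. \<phi> s t))"
  by (simp only: coef_def[of e] coef_additive[OF additive_zmul] coef_sum)

lemma coef_monom:
  assumes "j < p - 1" "e < p - 1"
  shows "coef e (\<lambda>t. zmul (int t ^ j) b) = (if j = e then b else 0)"
proof -
  have p_Suc: "p ^ Suc (p - 1) = p ^ p" and n_le: "n \<le> Suc (p - 1)"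
    using n_le_p prime_gt_0_nat[OF prime_p] by (simp_all del: power_Suc)
  have "coef e (\<lambda>t. zmul (int t ^ j) b) =
      zmul (- int (\<Sum>i<n. p ^ i)) (zmul (\<Sum>i<p - 1. int \<xi> ^ ((p - 1 - i) * e + i * j)) b)"
    by (simp add: coef_def zmul.scale_sum_left power_add power_mult)
  also have "\<dots> = zmul (- int (\<Sum>i<n. p ^ i)) (zmul (if j = e then int p - 1 else 0) b)"
    using sum_powers_root_of_unity_orthogonal[OF prime_p, of "p - 1", unfolded p_Suc, OF primroot n_le assms]
      prime_gt_0_nat[OF prime_p]
    by (simp add: of_nat_diff zmul_cong)
  also have "\<dots> = (if j = e then zmul (1 - int (p ^ n)) b else 0)"
  proof -
    have "- int (\<Sum>i<n. p ^ i) * (int p - 1) = 1 - int (p ^ n)"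
      using power_diff_1_eq[of "int p" n] by (simp add: algebra_simps)
    then show ?thesis
      by (simp only: zmul.scale_scale zmul.scale_zero_left zmul.scale_zero_right split: if_split) simp
  qed
  also have "\<dots> = (if j = e then b else 0)"
    using torsion[of b] by (simp add: zmul.scale_left_diff_distrib)
  finally show ?thesis .
qed

lemma less_k_imp_less: "j < k \<Longrightarrow> j < p - 1"
  using k_less_p by simp

lemma one_less: "1 < p - 1"
  using k_ge_2 k_less_p by simp

lemma deriv_at_0_const: "deriv_at_0 (\<lambda>t. b) = 0"
  using coef_monom[of 0 1 b] one_less by simp

lemma coef_eval_poly:
  assumes "e < k"
  shows "coef e (eval_poly c) = c e"
proof -
  have "coef e (eval_poly c) = (\<Sum>j<k. if j = e then c j else 0)"
    unfolding eval_poly_def coef_sum by (intro sum.cong refl coef_monom) (use less_k_imp_less assms in auto)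
  then show ?thesis using assms by simp
qed

lemma deriv_at_0_zmul:
  assumes "polymap (Suc s) \<phi>"
  shows "deriv_at_0 (\<lambda>t. zmul (int t) (\<phi> t)) = \<phi> 0"
proof -
  obtain c where c: "\<And>j. c j \<in> F (Suc s + j)" and \<phi>: "\<phi> = eval_poly c"
    using polymap_nat_eq_eval_poly[OF assms] by blast
  have "deriv_at_0 (\<lambda>t. zmul (int t) (\<phi> t)) = (\<Sum>j<k. deriv_at_0 (\<lambda>t. zmul (int t ^ Suc j) (c j)))"
    by (simp add: \<phi> eval_poly_def zmul.scale_sum_right coef_sum)
  also have "\<dots> = (\<Sum>j<k. if j = 0 then c 0 else 0)"
  proof (intro sum.cong refl)
    fix j
    show "deriv_at_0 (\<lambda>t. zmul (int t ^ Suc j) (c j)) = (if j = 0 then c 0 else 0)"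
    proof (cases "Suc j < k")
      case True
      then show ?thesis using coef_monom[of "Suc j" 1 "c j"] less_k_imp_less one_less by simp
    next
      case False
      then have "c j = 0" using F_eq_zero[OF c[of j]] by simp
      then show ?thesis using False k_ge_2 by (simp add: coef_zero)
    qed
  qed
  finally show ?thesis using k_ge_2 by (simp add: \<phi> eval_poly_0)
qed

lemma deriv_at_0_zmul_power:
  assumes "polymap (s + i) \<phi>"
  shows "deriv_at_0 (\<lambda>t. zmul (int t ^ i) (\<phi> t)) = (if i = 0 then deriv_at_0 \<phi> else if i = 1 then \<phi> 0 else 0)"
proof (cases i)
  case (Suc j)
  with assms have "polymap (Suc s) (\<lambda>t. zmul (int t ^ j) (\<phi> t))" by (intro polymap_zmul_power) simp
  from deriv_at_0_zmul[OF this] show ?thesis using Suc by (simp add: power_0_left)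
qed simp

lemma deriv_at_0_diagonal:
  fixes \<Phi> :: "nat \<times> nat \<Rightarrow> 'a"
  assumes "polymap s \<Phi>"
  shows "deriv_at_0 (\<lambda>t. \<Phi> (t, t)) = deriv_at_0 (\<lambda>t. \<Phi> (t, 0)) + deriv_at_0 (\<lambda>t. \<Phi> (0, t))"
proof -
  define c where "c e t = taylor_coeff (1, 0) \<Phi> e (0, t)" for e t
  have "((\<lambda>y. y + (1, 0)) ^^ r) (0, t) = (r, t)" for r t :: nat
    by (induction r) auto
  then have \<Phi>: "\<Phi> (r, t) = eval_poly (\<lambda>e. c e t) r" for r t
    using taylor_expansion[OF assms, where h = "(1, 0)" and x = "(0, t)" and t = r] by (simp add: c_def)
  have c: "polymap (s + e) (c e)" for e
    unfolding c_def by (rule polymap_comp_hom[OF _ polymap_taylor_coeff[OF assms]]) simp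
  have "deriv_at_0 (\<lambda>t. \<Phi> (t, t)) = (\<Sum>e<k. deriv_at_0 (\<lambda>t. zmul (int t ^ e) (c e t)))"
    by (simp add: \<Phi> eval_poly_def coef_sum)
  also have "\<dots> = (\<Sum>e<k. (if e = 0 then deriv_at_0 (c 0) else 0) + (if e = 1 then c 1 0 else 0))"
    by (intro sum.cong refl, subst deriv_at_0_zmul_power[OF c]) auto
  also have "\<dots> = deriv_at_0 (c 0) + c 1 0"
    using k_ge_2 by (simp add: sum.distrib)
  also have "c 1 0 = deriv_at_0 (\<lambda>t. \<Phi> (t, 0))"
    using coef_eval_poly[of 1 "\<lambda>e. c e 0"] k_ge_2 by (simp add: \<Phi>)
  also have "c 0 = (\<lambda>t. \<Phi> (0, t))"
    by (simp add: \<Phi> eval_poly_0)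
  finally show ?thesis by simp
qed

lemma polymap_divide_by_variable:
  fixes \<phi> :: "nat \<Rightarrow> 'a"
  assumes "polymap s \<phi>" "\<phi> 0 = 0"
  obtains \<psi> where "polymap (Suc s) \<psi>" "\<phi> = (\<lambda>t. zmul (int t) (\<psi> t))" "\<psi> 0 = deriv_at_0 \<phi>"
proof -
  obtain c where c: "\<And>j. c j \<in> F (s + j)" and \<phi>: "\<phi> = eval_poly c"
    using polymap_nat_eq_eval_poly[OF assms(1)] by blast
  let ?\<psi> = "eval_poly (\<lambda>j. c (Suc j))"
  have \<psi>: "polymap (Suc s) ?\<psi>"
    using polymap_eval_poly[of "\<lambda>j. c (Suc j)" "Suc s"] c[of "Suc _"] by simp
  have "c 0 = 0" "c k = 0"
    using assms(2) c[of k] F_eq_zero by (simp_all add: \<phi> eval_poly_0)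
  then have "eval_poly c t = zmul (int t) (?\<psi> t)" for t
    using sum.lessThan_Suc_shift[of "\<lambda>j. zmul (int t ^ j) (c j)" k]
    by (simp add: eval_poly_def zmul.scale_sum_right)
  then have eq: "\<phi> = (\<lambda>t. zmul (int t) (?\<psi> t))" by (auto simp: \<phi>)
  show thesis using that[OF \<psi> eq] deriv_at_0_zmul[OF \<psi>] eq by simp
qed

section \<open>Linear differential equations\<close>

lemma deriv_at_0_eval_poly_shift:
  "deriv_at_0 (\<lambda>s. eval_poly c (s + t)) = (\<Sum>j<k. zmul (int j * int t ^ (j - 1)) (c j))"
  unfolding eval_poly_def coef_sum
proof (intro sum.cong refl)
  fix j assume j: "j \<in> {..<k}"
  have "deriv_at_0 (\<lambda>s. zmul (int (s + t) ^ j) (c j)) =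
      deriv_at_0 (\<lambda>s. \<Sum>i\<le>j. zmul (int s ^ i) (zmul (int (j choose i) * int t ^ (j - i)) (c j)))"
    by (simp add: binomial_ring zmul.scale_sum_left algebra_simps)
  also have "\<dots> = (\<Sum>i\<le>j. if i = 1 then zmul (int (j choose i) * int t ^ (j - i)) (c j) else 0)"
    unfolding coef_sum by (intro sum.cong refl, subst coef_monom) (use j less_k_imp_less[of j] one_less in auto)
  also have "\<dots> = zmul (int j * int t ^ (j - 1)) (c j)"
    by (cases "j = 0") (auto simp: sum.delta)
  finally show "deriv_at_0 (\<lambda>s. zmul (int (s + t) ^ j) (c j)) = zmul (int j * int t ^ (j - 1)) (c j)" .
qed

lemma linear_ode_recursion:
  assumes f: "additive f" and "c k = 0"
    and ode: "\<And>t. deriv_at_0 (\<lambda>s. eval_poly c (s + t)) = v + f (eval_poly c t)"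
    and "j < k"
  shows "zmul (int (Suc j)) (c (Suc j)) = (if j = 0 then v else 0) + f (c j)"
proof -
  let ?v = "\<lambda>j. if j = 0 then v else 0"
  have "eval_poly (\<lambda>j. zmul (int (Suc j)) (c (Suc j))) t = eval_poly (\<lambda>j. ?v j + f (c j)) t" for t
  proof -
    have "eval_poly (\<lambda>j. zmul (int (Suc j)) (c (Suc j))) t = (\<Sum>j<Suc k. zmul (int j * int t ^ (j - 1)) (c j))"
      by (subst sum.lessThan_Suc_shift) (simp add: eval_poly_def mult.commute)
    also have "\<dots> = v + f (eval_poly c t)"
      using ode[of t] \<open>c k = 0\<close> unfolding deriv_at_0_eval_poly_shift by simp
    also have "v = eval_poly ?v t"
      using k_ge_2 by (simp add: eval_poly_def if_distrib[of "zmul _"] cong: if_cong)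
    finally show ?thesis
      by (simp add: eval_poly_def additive.sum[OF f] additive.zmul[OF f] zmul.scale_right_distrib sum.distrib)
  qed
  then have "coef j (eval_poly (\<lambda>j. zmul (int (Suc j)) (c (Suc j)))) = coef j (eval_poly (\<lambda>j. ?v j + f (c j)))"
    by presburger
  then show ?thesis by (simp only: coef_eval_poly[OF \<open>j < k\<close>])
qed

lemma divided_recursion_solution:
  fixes c :: "nat \<Rightarrow> 'a"
  assumes f: "additive f"
    and step: "\<And>j. j < k \<Longrightarrow> zmul (int (Suc j)) (c (Suc j)) = (if j = 0 then v else 0) + f (c j)"
    and "j \<le> k"
  shows "c j = zmul (inv_factorial j) ((f ^^ j) (c 0) + (if j = 0 then 0 else (f ^^ (j - 1)) v))"
  using \<open>j \<le> k\<close>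
proof (induction j)
  case 0
  then show ?case by simp
next
  case (Suc j)
  interpret additive f by fact
  let ?a = "\<lambda>j. (f ^^ j) (c 0) + (if j = 0 then 0 else (f ^^ (j - 1)) v)"
  have "Suc j < p" using Suc.prems k_less_p by simp
  have "zmul (int (Suc j)) (c (Suc j)) = (if j = 0 then v else 0) + f (zmul (inv_factorial j) (?a j))"
    using step[of j] Suc by simp
  also have "\<dots> = zmul (inv_factorial j) (?a (Suc j))"
    by (cases j) (simp_all add: zmul add)
  also have "\<dots> = zmul (int (Suc j)) (zmul (inv_factorial (Suc j)) (?a (Suc j)))"
    by (rule inv_factorial_Suc[OF \<open>Suc j < p\<close>, symmetric])
  finally show ?case by (rule zmul_nat_cancel[OF zero_less_Suc \<open>Suc j < p\<close>])
qed

lemma linear_ode_solution: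
  assumes f: "filtered_hom 1 f" and \<phi>: "polymap 0 \<phi>"
    and ode: "\<And>t. deriv_at_0 (\<lambda>s. \<phi> (s + t)) = v + f (\<phi> t)"
  shows "\<phi> 1 = phi 0 f (\<phi> 0) + phi 1 f v"
proof -
  note additive = filtered_hom_additive[OF f]
  obtain c where c: "\<And>j. c j \<in> F j" and \<phi>: "\<phi> = eval_poly c"
    using polymap_nat_eq_eval_poly[OF \<phi>] by auto
  have "c k = 0" using c[of k] by (rule F_k)
  have c_eq: "c j = zmul (inv_factorial j) ((f ^^ j) (c 0) + (if j = 0 then 0 else (f ^^ (j - 1)) v))"
    if "j \<le> k" for j
    using linear_ode_recursion[of f c v, OF additive \<open>c k = 0\<close>] ode that
    by (intro divided_recursion_solution[OF additive]) (simp_all add: \<phi>)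
  have "\<phi> 1 = (\<Sum>j<Suc k. c j)"
    by (simp add: \<phi> eval_poly_def \<open>c k = 0\<close>)
  also have "\<dots> = (\<Sum>j<Suc k. zmul (inv_factorial j) ((f ^^ j) (c 0)) +
      zmul (inv_factorial j) (if j = 0 then 0 else (f ^^ (j - 1)) v))"
    by (intro sum.cong refl, subst c_eq) (simp_all only: lessThan_iff less_Suc_eq_le zmul.scale_right_distrib)
  also have "\<dots> = (\<Sum>j<Suc k. zmul (inv_factorial j) ((f ^^ j) (c 0))) +
      (\<Sum>j<Suc k. zmul (inv_factorial j) (if j = 0 then 0 else (f ^^ (j - 1)) v))"
    by (rule sum.distrib)
  also have "(\<Sum>j<Suc k. zmul (inv_factorial j) (if j = 0 then 0 else (f ^^ (j - 1)) v)) = phi 1 f v"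
    by (subst sum.lessThan_Suc_shift) (simp add: phi_def)
  also have "(\<Sum>j<Suc k. zmul (inv_factorial j) ((f ^^ j) (c 0))) = phi 0 f (\<phi> 0)"
    using phi_Suc_k[OF f, of "c 0" 0] F_0 by (simp add: \<phi> eval_poly_0)
  finally show ?thesis .
qed

end

section \<open>The pre-Lie ring of a filtered brace\<close>

locale filtered_brace = primroot_filtration k F p n \<gamma>
  for k and F :: "nat \<Rightarrow> 'a::ab_group_add set" and p n \<gamma> +
  fixes star :: "'a \<Rightarrow> 'a \<Rightarrow> 'a"
  assumes star_add_right: "star a (b + d) = star a b + star a d"
    and star_circ_left: "star (a + b + star a b) d = star a (star b d) + star a d + star b d"
    and F_star: "a \<in> F i \<Longrightarrow> b \<in> F j \<Longrightarrow> star a b \<in> F (i + j)"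
begin

sublocale star: additive "star a" for a
  by unfold_locales (rule star_add_right)

lemma filtered_hom_star: "filtered_hom 1 (star a)"
  using F_star[of a "Suc 0"] F_1 by (intro filtered_homI) (simp_all add: star_add_right)

lemma star_0_left [simp]: "star 0 d = 0"
proof -
  have "star 0 d \<in> F i" for i
  proof (induction i)
    case (Suc i)
    have "star 0 d = - star 0 (star 0 d)"
      using star_circ_left[of 0 0 d] by (simp add: star.zero eq_neg_iff_add_eq_0 add.commute)
    then show ?case using F_uminus[OF filtered_hom_F[OF filtered_hom_star Suc, of 0]] by simp
  qed (simp add: F_0)
  then show ?thesis by (rule F_k)
qed

definition lam_inv :: "'a \<Rightarrow> 'a \<Rightarrow> 'a" where
  "lam_inv a b = (\<Sum>i<k. zmul ((- 1) ^ i) ((star a ^^ i) b))"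

lemma lam_inv: "lam_inv a b + star a (lam_inv a b) = b"
proof -
  let ?T = "\<lambda>i. zmul ((- 1) ^ i) ((star a ^^ i) b)"
  have "lam_inv a b + star a (lam_inv a b) = - (\<Sum>i<k. ?T (Suc i) - ?T i)"
    unfolding lam_inv_def star.sum star.zmul by (simp add: sum_subtractf sum_negf)
  also have "\<dots> = - (?T k - ?T 0)" by (rule arg_cong[OF sum_lessThan_telescope[of ?T]])
  also have "\<dots> = b" by (simp add: funpow_eq_zero[OF filtered_hom_star] F_0)
  finally show ?thesis .
qed

lemma additive_lam_inv: "additive (lam_inv a)"
proof
  show "lam_inv a (x + y) = lam_inv a x + lam_inv a y" for x y
    using additive.add[OF additive_funpow[OF star.additive_axioms]]
    by (simp add: lam_inv_def zmul.scale_right_distrib sum.distrib)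
qed

lemma star_add_left: "star (a + b) d = star a d + (star (lam_inv a b) d + star a (star (lam_inv a b) d))"
proof -
  have "a + b = a + lam_inv a b + star a (lam_inv a b)" using lam_inv[of a b] by (simp add: add.assoc)
  then show ?thesis using star_circ_left[of a "lam_inv a b" d] by (simp add: algebra_simps)
qed

text \<open>The maps obtained from polynomial maps by means of \<open>*\<close> are closed under differences, so they are
  polynomial.\<close>

inductive star_poly :: "nat \<Rightarrow> ('m::plus \<Rightarrow> 'a) \<Rightarrow> bool" where
  polymap: "polymap s \<phi> \<Longrightarrow> star_poly s \<phi>"
| antimono: "star_poly s \<phi> \<Longrightarrow> s' \<le> s \<Longrightarrow> star_poly s' \<phi>"
| add: "star_poly s \<phi> \<Longrightarrow> star_poly s \<psi> \<Longrightarrow> star_poly s (\<lambda>x. \<phi> x + \<psi> x)"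
| zmul: "star_poly s \<phi> \<Longrightarrow> star_poly s (\<lambda>x. zmul r (\<phi> x))"
| star: "star_poly s \<phi> \<Longrightarrow> star_poly r \<psi> \<Longrightarrow> star_poly (s + r) (\<lambda>x. star (\<phi> x) (\<psi> x))"

lemma star_poly_F: "star_poly s \<phi> \<Longrightarrow> \<phi> x \<in> F s"
proof (induction rule: star_poly.induct)
  case (antimono s \<phi> s')
  then show ?case using F_antimono by blast
qed (simp_all add: polymap_F F_add F_zmul F_star)

lemma star_poly_sum: "(\<And>i. i \<in> S \<Longrightarrow> star_poly s (\<phi> i)) \<Longrightarrow> star_poly s (\<lambda>x. \<Sum>i\<in>S. \<phi> i x)"
  by (induction S rule: infinite_finite_induct)
    (simp_all add: star_poly.add star_poly.polymap polymap_const F_zero)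

lemma star_poly_lam_inv:
  assumes "star_poly r \<phi>" "star_poly s \<psi>"
  shows "star_poly s (\<lambda>x. lam_inv (\<phi> x) (\<psi> x))"
proof -
  have "star_poly s (\<lambda>x. (star (\<phi> x) ^^ i) (\<psi> x))" for i
  proof (induction i)
    case (Suc i)
    from star_poly.star[OF assms(1) this] show ?case by (auto intro: star_poly.antimono)
  qed (simp add: assms)
  then show ?thesis
    unfolding lam_inv_def by (intro star_poly_sum star_poly.zmul)
qed

lemma forward_diff_star:
  "forward_diff h (\<lambda>x. star (\<phi> x) (\<psi> x)) =
    (\<lambda>x. star (\<phi> x + forward_diff h \<phi> x) (forward_diff h \<psi> x) +
      (star (lam_inv (\<phi> x) (forward_diff h \<phi> x)) (\<psi> x) +
       star (\<phi> x) (star (lam_inv (\<phi> x) (forward_diff h \<phi> x)) (\<psi> x))))"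
proof
  fix x
  have "forward_diff h (\<lambda>x. star (\<phi> x) (\<psi> x)) x =
      star (\<phi> (x + h)) (forward_diff h \<psi> x) + (star (\<phi> x + forward_diff h \<phi> x) (\<psi> x) - star (\<phi> x) (\<psi> x))"
    by (simp add: forward_diff_def star.diff)
  then show "forward_diff h (\<lambda>x. star (\<phi> x) (\<psi> x)) x = star (\<phi> x + forward_diff h \<phi> x) (forward_diff h \<psi> x) +
      (star (lam_inv (\<phi> x) (forward_diff h \<phi> x)) (\<psi> x) +
       star (\<phi> x) (star (lam_inv (\<phi> x) (forward_diff h \<phi> x)) (\<psi> x)))"
    by (simp add: star_add_left[of "\<phi> x" "forward_diff h \<phi> x" "\<psi> x"]) (simp add: forward_diff_def)
qed

lemma star_poly_forward_diff: "star_poly s \<phi> \<Longrightarrow> star_poly (Suc s) (forward_diff h \<phi>)"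
proof (induction rule: star_poly.induct)
  case (polymap s \<phi>)
  then show ?case by (intro star_poly.polymap polymap_forward_diff)
next
  case (antimono s \<phi> s')
  then show ?case by (auto intro: star_poly.antimono)
next
  case (add s \<phi> \<psi>)
  from star_poly.add[OF add.IH] show ?case by (simp add: forward_diff_def add_diff_add)
next
  case (zmul s \<phi> r)
  from star_poly.zmul[OF zmul.IH, of r] show ?case
    by (simp add: forward_diff_def zmul.scale_right_diff_distrib)
next
  case (star s \<phi> r \<psi>)
  have shift: "star_poly s (\<lambda>x. \<phi> x + forward_diff h \<phi> x)"
    by (rule star_poly.add[OF star.hyps(1) star_poly.antimono[OF star.IH(1)]]) simp
  have "star_poly (Suc s) (\<lambda>x. lam_inv (\<phi> x) (forward_diff h \<phi> x))"
    by (rule star_poly_lam_inv[OF star.hyps(1) star.IH(1)])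
  from star_poly.star[OF this star.hyps(2)]
  have inner: "star_poly (Suc (s + r)) (\<lambda>x. star (lam_inv (\<phi> x) (forward_diff h \<phi> x)) (\<psi> x))"
    by simp
  have outer: "star_poly (Suc (s + r)) (\<lambda>x. star (\<phi> x) (star (lam_inv (\<phi> x) (forward_diff h \<phi> x)) (\<psi> x)))"
    by (rule star_poly.antimono[OF star_poly.star[OF star.hyps(1) inner]]) simp
  show ?case
    unfolding forward_diff_star
    using star_poly.star[OF shift star.IH(2)] inner outer by (intro star_poly.add) simp_all
qed

lemma star_poly_imp_polymap: "star_poly s \<phi> \<Longrightarrow> polymap s \<phi>"
  by (rule polymap_coinduct[where P = star_poly]) (simp_all add: star_poly_F star_poly_forward_diff)

lemma polymap_star: "polymap s \<phi> \<Longrightarrow> polymap r \<psi> \<Longrightarrow> polymap (s + r) (\<lambda>x. star (\<phi> x) (\<psi> x))"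
  by (rule star_poly_imp_polymap[OF star_poly.star[OF star_poly.polymap star_poly.polymap]])

lemma polymap_lam_inv: "polymap r \<phi> \<Longrightarrow> polymap s \<psi> \<Longrightarrow> polymap s (\<lambda>x. lam_inv (\<phi> x) (\<psi> x))"
  by (rule star_poly_imp_polymap[OF star_poly_lam_inv[OF star_poly.polymap star_poly.polymap]])

definition dot :: "'a \<Rightarrow> 'a \<Rightarrow> 'a" where
  "dot a b = deriv_at_0 (\<lambda>t. star (zmul (int t) a) b)"

lemma polymap_linear: "polymap 0 (\<lambda>t. zmul (int t) a)"
  by (intro polymap_zmul_hom polymap_const) (simp_all add: F_1)

lemma deriv_at_0_linear: "deriv_at_0 (\<lambda>t. zmul (int t) a) = a"
  using deriv_at_0_zmul[OF polymap_const, of a 0] by (simp add: F_1)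

lemma deriv_at_0_star_const:
  assumes "polymap 0 \<phi>" "\<phi> 0 = 0"
  shows "deriv_at_0 (\<lambda>t. star (\<phi> t) b) = dot (deriv_at_0 \<phi>) b"
proof -
  obtain \<psi> where \<psi>: "polymap (Suc 0) \<psi>" "\<psi> 0 = deriv_at_0 \<phi>" and \<phi>: "\<phi> = (\<lambda>t. zmul (int t) (\<psi> t))"
    using polymap_divide_by_variable[OF assms] by metis
  define \<Phi> where "\<Phi> x = star (zmul (int (fst x)) (\<psi> (snd x))) b" for x
  have "polymap (Suc 0) (\<lambda>x::nat \<times> nat. \<psi> (snd x))"
    by (rule polymap_comp_hom[OF _ \<psi>(1)]) simp
  from polymap_zmul_hom[OF _ this, of "\<lambda>x. int (fst x)"]
  have "polymap 0 (\<lambda>x::nat \<times> nat. zmul (int (fst x)) (\<psi> (snd x)))" by simp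
  from polymap_star[OF this polymap_const[of b 0]] have "polymap 0 \<Phi>"
    unfolding \<Phi>_def by (simp add: F_0)
  from deriv_at_0_diagonal[OF this] have "deriv_at_0 (\<lambda>t. star (\<phi> t) b) = dot (\<psi> 0) b"
    by (simp add: \<phi> \<Phi>_def dot_def coef_zero)
  then show ?thesis by (simp only: \<psi>(2))
qed

lemma deriv_at_0_star:
  assumes "polymap 0 \<phi>" "\<phi> 0 = 0" "polymap s \<psi>"
  shows "deriv_at_0 (\<lambda>t. star (\<phi> t) (\<psi> t)) = dot (deriv_at_0 \<phi>) (\<psi> 0)"
proof -
  have "polymap (0 + s) (\<lambda>x::nat \<times> nat. star (\<phi> (fst x)) (\<psi> (snd x)))"
    by (intro polymap_star polymap_comp_hom[OF _ assms(1)] polymap_comp_hom[OF _ assms(3)]) simp_all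
  from deriv_at_0_diagonal[OF this] show ?thesis
    using deriv_at_0_star_const[OF assms(1,2)] by (simp add: assms(2) coef_zero)
qed

lemma dot_add_right: "dot x (y + z) = dot x y + dot x z"
  by (simp add: dot_def star_add_right coef_add)

text \<open>Compare the derivatives of \<open>((t a) \<circ> (t c)) * b\<close>.\<close>

lemma dot_add_left: "dot (a + c) b = dot a b + dot c b"
proof -
  let ?a = "\<lambda>t. zmul (int t) a" and ?c = "\<lambda>t. zmul (int t) c"
  have lin: "polymap 0 ?a" "polymap 0 ?c" by (rule polymap_linear)+
  have circ: "polymap 0 (\<lambda>t. ?a t + ?c t + star (?a t) (?c t))"
    using polymap_star[OF lin] lin by (intro polymap_add) simp_all
  have cb: "polymap (0 + 0) (\<lambda>t. star (?c t) b)"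
    by (intro polymap_star lin polymap_const) (simp add: F_0)
  have "deriv_at_0 (\<lambda>t. ?a t + ?c t + star (?a t) (?c t)) = a + c + dot a 0"
    by (simp add: coef_add deriv_at_0_linear deriv_at_0_star[OF lin(1) _ lin(2)])
  then have "dot (a + c) b = deriv_at_0 (\<lambda>t. star (?a t + ?c t + star (?a t) (?c t)) b)"
    using deriv_at_0_star_const[OF circ, of b] by (simp add: dot_def coef_zero star.zero)
  also have "\<dots> = dot a b + dot c b"
    unfolding star_circ_left
    by (simp add: coef_add deriv_at_0_star[OF lin(1) _ cb]) (simp add: dot_def coef_zero star.zero)
  finally show ?thesis .
qed

lemma F_dot: "a \<in> F i \<Longrightarrow> b \<in> F j \<Longrightarrow> dot a b \<in> F (i + j)"
  unfolding dot_def coef_def by (intro F_zmul F_sum F_star)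

sublocale dot: filtered_algebra k F p n dot
  by unfold_locales (fact dot_add_left dot_add_right F_dot)+

lemma deriv_at_0_lam_inv: "deriv_at_0 (\<lambda>s. lam_inv (zmul (int s) x) y) = - dot x y"
proof -
  have "polymap 0 (\<lambda>s. lam_inv (zmul (int s) x) y)"
    by (rule polymap_lam_inv[OF polymap_linear polymap_const]) (simp add: F_0)
  from deriv_at_0_star[OF polymap_linear _ this, of x]
  have "deriv_at_0 (\<lambda>s. star (zmul (int s) x) (lam_inv (zmul (int s) x) y)) = dot x y"
    using lam_inv[of 0 y] by (simp add: deriv_at_0_linear)
  moreover have "deriv_at_0 (\<lambda>s. lam_inv (zmul (int s) x) y) +
      deriv_at_0 (\<lambda>s. star (zmul (int s) x) (lam_inv (zmul (int s) x) y)) = 0"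
    unfolding coef_add[symmetric] lam_inv by (rule deriv_at_0_const)
  ultimately show ?thesis by (simp add: eq_neg_iff_add_eq_0)
qed

text \<open>The associator is the mixed second derivative of \<open>(s x + t y) * d\<close>, which is symmetric.\<close>

lemma dot_associator:
  "deriv_at_0 (\<lambda>s. deriv_at_0 (\<lambda>t. star (zmul (int s) x + zmul (int t) y) d)) =
    dot x (dot y d) - dot (dot x y) d"
proof -
  let ?x = "\<lambda>s. zmul (int s) x"
  let ?y = "\<lambda>s. lam_inv (?x s) y"
  have "deriv_at_0 (\<lambda>t. star (?x s + zmul (int t) y) d) = dot (?y s) d + star (?x s) (dot (?y s) d)" for s
    by (simp add: star_add_left additive.zmul[OF additive_lam_inv] coef_add deriv_at_0_const
        coef_additive[OF star.additive_axioms] dot_def star.zero)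
  moreover have "polymap (0 + 0) (\<lambda>s. dot (?y s) d)"
  proof (rule polymap_filtered_hom[where f = "\<lambda>x. dot x d"])
    show "filtered_hom 0 (\<lambda>x. dot x d)"
      using F_dot[of _ _ d 0] by (intro filtered_homI dot_add_left) (simp add: F_0)
    show "polymap 0 ?y" by (rule polymap_lam_inv[OF polymap_linear polymap_const]) (simp add: F_0)
  qed
  from deriv_at_0_star[OF polymap_linear _ this, of x]
  have "deriv_at_0 (\<lambda>s. star (?x s) (dot (?y s) d)) = dot x (dot y d)"
    using lam_inv[of 0 y] by (simp add: deriv_at_0_linear)
  moreover have "deriv_at_0 (\<lambda>s. dot (?y s) d) = - dot (dot x y) d"
    by (simp add: coef_additive[OF dot.mult_left.additive_axioms] deriv_at_0_lam_inv dot.mult_left.minus)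
  ultimately show ?thesis by (simp add: coef_add)
qed

lemma dot_prelie: "dot (dot x y) z - dot x (dot y z) = dot (dot y x) z - dot y (dot x z)"
proof -
  have "deriv_at_0 (\<lambda>s. deriv_at_0 (\<lambda>t. star (zmul (int s) x + zmul (int t) y) z)) =
      deriv_at_0 (\<lambda>s. deriv_at_0 (\<lambda>t. star (zmul (int s) y + zmul (int t) x) z))"
    by (subst coef_swap) (simp add: add.commute)
  then show ?thesis unfolding dot_associator by (simp add: algebra_simps)
qed

section \<open>Logarithms in the circle group\<close>

definition circ_power :: "'a \<Rightarrow> nat \<Rightarrow> 'a" where
  "circ_power a t = ((\<lambda>y. a + y + star a y) ^^ t) 0"

lemma circ_power_0: "circ_power a 0 = 0"
  by (simp add: circ_power_def)

lemma circ_power_1: "circ_power a (Suc 0) = a"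
  by (simp add: circ_power_def star.zero)

lemma circ_power_add:
  "circ_power a (s + t) = circ_power a s + circ_power a t + star (circ_power a s) (circ_power a t)"
proof (induction s)
  case 0
  then show ?case by (simp add: circ_power_0)
next
  case (Suc s)
  have Suc_eq: "circ_power a (Suc t) = a + circ_power a t + star a (circ_power a t)" for t
    by (simp add: circ_power_def)
  show ?case
    by (simp only: add_Suc Suc_eq Suc star_circ_left star_add_right) (simp add: algebra_simps)
qed

lemma polymap_circ_power: "polymap 0 (circ_power a)"
proof (rule polymap_coinduct[where
      P = "\<lambda>s \<phi>. \<exists>g b. filtered_hom s g \<and> b \<in> F s \<and> \<phi> = (\<lambda>t. g (circ_power a t) + b)"])
  have "filtered_hom 0 (\<lambda>x. x)" by (intro filtered_homI) simp_all
  then show "\<exists>g b. filtered_hom 0 g \<and> b \<in> F 0 \<and> circ_power a = (\<lambda>t. g (circ_power a t) + b)"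
    using F_zero by force
  fix s \<phi>
  assume "\<exists>g b. filtered_hom s g \<and> b \<in> F s \<and> \<phi> = (\<lambda>t. g (circ_power a t) + b)"
  then obtain g b where g: "filtered_hom s g" and b: "b \<in> F s" and \<phi>: "\<phi> = (\<lambda>t. g (circ_power a t) + b)"
    by blast
  show "\<phi> t \<in> F s" for t
    using filtered_hom_F[OF g, of _ 0] F_0 b by (simp add: \<phi> F_add)
  fix h
  let ?h = "circ_power a h"
  have "forward_diff h \<phi> = (\<lambda>t. g (star ?h (circ_power a t)) + g ?h)"
    using circ_power_add[of a h] additive.add[OF filtered_hom_additive[OF g]]
    by (auto simp: forward_diff_def \<phi> add.commute)
  moreover have "g ?h \<in> F (Suc s)" using filtered_hom_F[OF g, of ?h "Suc 0"] F_1 by simp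
  moreover have "filtered_hom (Suc s) (\<lambda>x. g (star ?h x))"
    using filtered_hom_compose[OF g filtered_hom_star] by simp
  ultimately show "\<exists>g b. filtered_hom (Suc s) g \<and> b \<in> F (Suc s) \<and>
      forward_diff h \<phi> = (\<lambda>t. g (circ_power a t) + b)"
    by blast
qed

text \<open>Differentiating \<open>a\<^sup>s\<^sup>+\<^sup>t = a\<^sup>s \<circ> a\<^sup>t\<close> at \<open>s = 0\<close> identifies the circle powers
  of \<open>a\<close> with a flow of \<open>dot\<close>.\<close>

lemma circ_log:
  obtains x where "dot.W x = a" "\<And>b. dot.E x b = b + star a b"
proof
  let ?x = "deriv_at_0 (circ_power a)"
  note deriv_at_0_star_power = deriv_at_0_star_const[OF polymap_circ_power circ_power_0]
  have hom: "filtered_hom 1 (dot ?x)"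
    by (rule dot.filtered_hom_mult_F_0) (simp add: F_0)
  have "deriv_at_0 (\<lambda>s. circ_power a (s + t)) = ?x + dot ?x (circ_power a t)" for t
    by (simp only: circ_power_add coef_add deriv_at_0_const deriv_at_0_star_power add_0_right)
  from linear_ode_solution[OF hom polymap_circ_power this] show "dot.W ?x = a"
    by (simp add: circ_power_0 circ_power_1 dot.W_def dot.E.zero)
  fix b
  let ?y = "\<lambda>t. b + star (circ_power a t) b"
  have "polymap (0 + 0) (\<lambda>t. star (circ_power a t) b)"
    by (intro polymap_star polymap_circ_power polymap_const) (simp add: F_0)
  then have y: "polymap 0 ?y"
    by (intro polymap_add polymap_const) (simp_all add: F_0)
  have "?y (s + t) = ?y t + star (circ_power a s) (?y t)" for s t
    by (simp only: circ_power_add star_circ_left star_add_right) (simp add: algebra_simps)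
  then have "deriv_at_0 (\<lambda>s. ?y (s + t)) = 0 + dot ?x (?y t)" for t
    by (simp only: coef_add deriv_at_0_const deriv_at_0_star_power add_0_left)
  from linear_ode_solution[OF hom y this] show "dot.E ?x b = b + star a b"
    by (simp add: circ_power_0 circ_power_1 additive.zero[OF additive_phi[OF dot.mult_right.additive_axioms]])
qed

end

section \<open>The strong series\<close>

declare strong_series.simps [simp del]

lemma strong_series_le_1: "i \<le> 1 \<Longrightarrow> strong_series op i = UNIV"
  by (subst strong_series.simps) simp

lemma addgen_least:
  assumes "S \<subseteq> H" "0 \<in> H" "\<And>a b. a \<in> H \<Longrightarrow> b \<in> H \<Longrightarrow> a - b \<in> H"
  shows "addgen S \<subseteq> H"
proof
  fix x assume "x \<in> addgen S"
  then show "x \<in> H" by induction (use assms in auto)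
qed

lemma strong_series_zero: "0 \<in> strong_series op i"
  by (subst strong_series.simps) (simp add: subsum_def addgen.zero)

lemma strong_series_diff: "a \<in> strong_series op i \<Longrightarrow> b \<in> strong_series op i \<Longrightarrow> a - b \<in> strong_series op i"
  by (subst strong_series.simps, subst (asm) (1 2) strong_series.simps)
    (auto simp: subsum_def intro: addgen.diff split: if_splits)

lemma strong_series_mult_pos:
  assumes "x \<in> strong_series op i" "y \<in> strong_series op j" "1 \<le> i" "1 \<le> j"
  shows "op x y \<in> strong_series op (i + j)"
proof -
  have "op x y \<in> subprod op (strong_series op i) (strong_series op (i + j - i))"
    unfolding subprod_def using assms by (auto intro!: addgen.base)
  then have "op x y \<in> subsum {1..i + j - 1}
      (\<lambda>l. subprod op (strong_series op l) (strong_series op (i + j - l)))"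
    unfolding subsum_def using assms by (intro addgen.base UN_I[of i]) auto
  then show ?thesis using assms by (subst strong_series.simps) auto
qed

lemma strong_series_least:
  assumes "0 \<in> H" "\<And>a b. a \<in> H \<Longrightarrow> b \<in> H \<Longrightarrow> a - b \<in> H" "2 \<le> i"
    and "\<And>x y j. x \<in> strong_series op j \<Longrightarrow> y \<in> strong_series op (i - j) \<Longrightarrow> 1 \<le> j \<Longrightarrow> j < i \<Longrightarrow> op x y \<in> H"
  shows "strong_series op i \<subseteq> H"
proof -
  have "strong_series op i = subsum {1..i - 1} (\<lambda>j. subprod op (strong_series op j) (strong_series op (i - j)))"
    using assms(3) by (subst strong_series.simps) simp
  also have "\<dots> \<subseteq> H"
    unfolding subsum_def subprod_def
    by (intro addgen_least UN_least) (use assms in \<open>auto\<close>)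
  finally show ?thesis .
qed

lemma strong_series_Suc: "strong_series op (Suc i) \<subseteq> strong_series op i"
proof (induction i rule: less_induct)
  case (less i)
  show ?case
  proof (cases "i \<le> 1")
    case True
    then show ?thesis by (simp add: strong_series_le_1)
  next
    case False
    have lower: "z \<in> strong_series op (j - 1)" if "z \<in> strong_series op j" "1 \<le> j" "j \<le> i" for z j
      using less[of "j - 1"] that by (cases j) auto
    show ?thesis
    proof (rule strong_series_least)
      fix x y j
      assume x: "x \<in> strong_series op j" and y: "y \<in> strong_series op (Suc i - j)" and j: "1 \<le> j" "j < Suc i"
      show "op x y \<in> strong_series op i"
      proof (cases "j = 1")
        case True
        then have "y \<in> strong_series op (i - 1)" using lower[of y i] y False by simp
        from strong_series_mult_pos[OF x this] show ?thesis using True False by simp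
      next
        case False
        then have "x \<in> strong_series op (j - 1)" using lower[OF x] j by simp
        from strong_series_mult_pos[OF this y] show ?thesis using False j by simp
      qed
    qed (use False in \<open>auto intro: strong_series_zero strong_series_diff\<close>)
  qed
qed

lemma strong_series_mult:
  assumes "x \<in> strong_series op i" "y \<in> strong_series op j"
  shows "op x y \<in> strong_series op (i + j)"
proof -
  have max: "z \<in> strong_series op (max 1 i)" if "z \<in> strong_series op i" for z i
    using that by (cases "i = 0") (auto simp: strong_series_le_1 max_def)
  have "op x y \<in> strong_series op (max 1 i + max 1 j)"
    by (intro strong_series_mult_pos max assms) auto
  moreover have "strong_series op (max 1 i + max 1 j) \<subseteq> strong_series op (i + j)"
    by (rule lift_Suc_antimono_le[of "strong_series op"]) (auto intro: subsetD[OF strong_series_Suc])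
  ultimately show ?thesis by blast
qed

lemma (in filtration) strong_series_subset_F:
  assumes "F 0 = UNIV" and op: "\<And>x y i j. x \<in> F i \<Longrightarrow> y \<in> F j \<Longrightarrow> op x y \<in> F (i + j)"
  shows "strong_series op i \<subseteq> F i"
proof (induction i rule: less_induct)
  case (less i)
  show ?case
  proof (cases "i \<le> 1")
    case True
    then have "i = 0 \<or> i = 1" by auto
    then show ?thesis using assms(1) F_0_subset_F_1 by auto
  next
    case False
    show ?thesis
    proof (rule strong_series_least)
      fix x y j
      assume "x \<in> strong_series op j" "y \<in> strong_series op (i - j)" "1 \<le> j" "j < i"
      then have "x \<in> F j" "y \<in> F (i - j)" using less[of j] less[of "i - j"] by auto
      from op[OF this] show "op x y \<in> F i" using \<open>j < i\<close> by simp
    qed (use False F_zero F_diff in auto)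
  qed
qed

lemma torsion_filtration_strong_series:
  fixes op :: "'a::{ab_group_add, finite} \<Rightarrow> 'a \<Rightarrow> 'a"
  assumes "prime p" "k < p" "2 \<le> k" "card (UNIV :: 'a set) = p ^ n" "strong_series op k \<subseteq> {0}"
  shows "torsion_filtration k (strong_series op) p n"
proof
  show "zmul (int (p ^ n)) x = 0" for x :: 'a using zmul_card_eq_zero[of x] assms by simp
  show "strong_series op 0 \<subseteq> strong_series op 1" by (simp add: strong_series_le_1)
qed (use assms in \<open>auto intro: strong_series_zero strong_series_diff dest: subsetD[OF strong_series_Suc]\<close>)

lemma nilpotency_index_ge_2: "nilpotency_index op k \<Longrightarrow> 2 \<le> k"
  by (rule ccontr) (auto simp: nilpotency_index_def strong_series_le_1)

section \<open>Nilpotent endomorphisms of finite groups\<close>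

lemma card_additive_subgroup_dvd:
  fixes H :: "'a::{ab_group_add, finite} set"
  assumes "0 \<in> H" "\<And>a b. a \<in> H \<Longrightarrow> b \<in> H \<Longrightarrow> a - b \<in> H"
  shows "card H dvd card (UNIV :: 'a set)"
proof -
  let ?G = "\<lparr>carrier = UNIV :: 'a set, monoid.mult = (+), one = 0\<rparr>"
  interpret group ?G
    by (rule groupI) (auto simp: add.assoc intro: exI[of _ "- _"])
  have inv: "inv\<^bsub>?G\<^esub> x = - x" for x by (rule inv_equality) auto
  have neg: "- a \<in> H" if "a \<in> H" for a using assms(2)[OF assms(1) that] by simp
  have "subgroup H ?G"
    by unfold_locales (use assms neg assms(2)[OF _ neg] inv in auto)
  then have "card (rcosets\<^bsub>?G\<^esub> H) * card H = order ?G" by (intro lagrange) auto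
  then show ?thesis unfolding order_def by (metis dvd_triv_right partial_object.select_convs(1))
qed

lemma card_range_additive_eq_prime_power:
  fixes f :: "'a::{ab_group_add, finite} \<Rightarrow> 'a"
  assumes "prime p" "card (UNIV :: 'a set) = p ^ n" "additive f"
  obtains a where "card (range f) = p ^ a"
proof -
  have "0 \<in> range f" using additive.zero[OF assms(3)] by (metis rangeI)
  then have "card (range f) dvd p ^ n"
    unfolding assms(2)[symmetric]
    by (rule card_additive_subgroup_dvd) (auto simp flip: additive.diff[OF assms(3)])
  then show ?thesis using assms(1) that by (auto simp: divides_primepow_nat)
qed

lemma nilpotent_image_eq_imp_subset:
  assumes "f ` S = S" "\<And>x. (f ^^ M) x = z"
  shows "S \<subseteq> {z}"
proof -
  have "(f ^^ i) ` S = S" for i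
  proof (induction i)
    case (Suc i)
    have "(f ^^ Suc i) ` S = f ` (f ^^ i) ` S" by (simp add: image_comp)
    then show ?case using Suc assms(1) by simp
  qed simp
  from this[of M] show ?thesis using assms(2) by auto
qed

text \<open>The images of the powers of \<open>f\<close> shrink by a factor of at least \<open>p\<close> until they vanish.\<close>

lemma nilpotent_additive_funpow_eq_zero:
  fixes f :: "'a::{ab_group_add, finite} \<Rightarrow> 'a"
  assumes p: "prime p" and card: "card (UNIV :: 'a set) = p ^ n"
    and f: "additive f" and nilpotent: "\<And>x. (f ^^ M) x = 0"
  shows "(f ^^ n) x = 0"
proof -
  note add = additive_funpow[OF f]
  define R where "R j = range (f ^^ j)" for j
  have zero: "0 \<in> R j" for j
    using additive.zero[OF add, of j] unfolding R_def by (metis rangeI)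
  have R_Suc: "R (Suc j) = f ` R j" for j by (auto simp: R_def image_comp)
  have "R j \<subseteq> {0} \<or> card (R j) * p ^ j \<le> p ^ n" for j
  proof (induction j)
    case 0
    then show ?case using card by (simp add: R_def)
  next
    case (Suc j)
    show ?case
    proof (cases "R j \<subseteq> {0}")
      case True
      then show ?thesis using R_Suc[of j] additive.zero[OF f] by auto
    next
      case False
      then have "R (Suc j) \<noteq> R j"
        using nilpotent_image_eq_imp_subset[of f "R j" M 0] nilpotent by (auto simp: R_Suc)
      moreover have "R (Suc j) \<subseteq> R j" by (auto simp: R_def funpow_swap1)
      ultimately have "card (R (Suc j)) < card (R j)" by (intro psubset_card_mono) auto
      moreover obtain a b where "card (R (Suc j)) = p ^ a" "card (R j) = p ^ b"
        using card_range_additive_eq_prime_power[OF p card add] unfolding R_def by metis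
      ultimately have "card (R (Suc j)) * p \<le> card (R j)"
        using prime_gt_1_nat[OF p] power_increasing[of "Suc a" b p] by (simp add: mult.commute)
      then have "card (R (Suc j)) * p * p ^ j \<le> card (R j) * p ^ j" by (rule mult_le_mono1)
      also have "\<dots> \<le> p ^ n" using Suc False by simp
      finally show ?thesis by (simp add: mult.assoc)
    qed
  qed
  from this[of n] have "R n \<subseteq> {0} \<or> card (R n) \<le> Suc 0"
    using prime_gt_0_nat[OF p] by auto
  then have "R n \<subseteq> {0}"
    using zero[of n] by (auto simp: card_le_Suc0_iff_eq)
  then show ?thesis by (auto simp: R_def)
qed

section \<open>The group of flows\<close>

lemma id_mult_pow: "(id_mult m (a, 0) ^^ j) (b, 0) = ((m a ^^ j) b, 0)"
  by (induction j) (simp_all add: id_mult_def)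

lemma id_mult_pow_one:
  assumes "m a 0 = 0"
  shows "(id_mult m (a, 0) ^^ Suc j) (0, 1) = ((m a ^^ j) a, 0)"
proof -
  have "id_mult m (a, 0) (0, 1) = (a, 0)" by (simp add: id_mult_def assms zmul_0_left)
  then show ?thesis by (simp add: funpow_Suc_right id_mult_pow del: funpow.simps)
qed

context filtered_algebra
begin

lemma E_zmul_eq_eval_poly: "E (zmul (int t) x) b = eval_poly (\<lambda>j. zmul (inv_factorial j) ((m x ^^ j) b)) t"
  by (simp add: phi_def eval_poly_def funpow_mult_zmul mult.commute)

lemma W_zmul_eq_eval_poly:
  assumes "x \<in> F 0"
  obtains c where "\<And>j. c j \<in> F j" "c 0 = 0" "c (Suc 0) = x" "\<And>t. W (zmul (int t) x) = eval_poly c t"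
proof
  define c where "c j = (if j = 0 then 0 else zmul (inv_factorial j) ((m x ^^ (j - 1)) x))" for j
  have c_F: "c j \<in> F j" for j
    using F_zmul[OF funpow_F[OF filtered_hom_mult_F_0[OF assms] assms]] by (cases j) (auto simp: c_def F_zero)
  show "c j \<in> F j" for j by (rule c_F)
  show "c 0 = 0" "c (Suc 0) = x" by (simp_all add: c_def)
  fix t
  have "W (zmul (int t) x) = (\<Sum>j<k. zmul (int t ^ Suc j) (c (Suc j)))"
    using additive.zmul[OF additive_funpow[OF mult_right.additive_axioms]]
    by (simp add: W_def phi_def c_def funpow_mult_zmul mult_ac)
  also have "\<dots> = (\<Sum>j<Suc k. zmul (int t ^ j) (c j))"
    by (subst sum.lessThan_Suc_shift) (simp add: c_def)
  also have "\<dots> = eval_poly c t"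
    using F_k[OF c_F[of k]] by (simp add: eval_poly_def)
  finally show "W (zmul (int t) x) = eval_poly c t" .
qed

end

locale finite_filtered_algebra = filtered_algebra k F p n m
  for k and F :: "nat \<Rightarrow> 'a::{ab_group_add, finite} set" and p n m +
  assumes card_UNIV: "card (UNIV :: 'a set) = p ^ n" and F_0: "F 0 = UNIV"
begin

lemma funpow_mult_eq_zero_k: "k \<le> Suc j \<Longrightarrow> (m a ^^ j) b = 0"
  by (rule funpow_eq_zero[OF filtered_hom_mult_F_0]) (simp_all add: F_0)

lemma funpow_mult_eq_zero_n: "n \<le> j \<Longrightarrow> (m a ^^ j) b = 0"
proof -
  assume "n \<le> j"
  have "(m a ^^ n) ((m a ^^ (j - n)) b) = 0"
    by (rule nilpotent_additive_funpow_eq_zero[OF prime_p card_UNIV mult_right.additive_axioms, where M = k])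
      (simp add: funpow_mult_eq_zero_k)
  then show ?thesis using \<open>n \<le> j\<close> by (metis funpow_add le_add_diff_inverse o_apply)
qed

lemma fst_expL: "fst (expL p n m a (b, 0)) = E a b"
proof -
  have "(\<Sum>j\<in>{1..n}. zmul (inv_factorial j) ((m a ^^ j) b)) =
      (\<Sum>j\<in>{1..<k}. zmul (inv_factorial j) ((m a ^^ j) b))"
    by (rule sum.mono_neutral_cong) (auto simp: funpow_mult_eq_zero_n funpow_mult_eq_zero_k)
  then show ?thesis
    unfolding expL_def phi_def lessThan_k_eq by (simp add: id_add_def id_mult_pow)
qed

lemma flowW_eq_W: "flowW p n m a = W a"
proof -
  have "flowW p n m a = (\<Sum>j\<in>{1..n}. zmul (inv_factorial j) (fst ((id_mult m (a, 0) ^^ j) (0, 1))))"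
    by (simp add: flowW_def expL_def id_add_def)
  also have "\<dots> = (\<Sum>j<n. zmul (inv_factorial (Suc j)) (fst ((id_mult m (a, 0) ^^ Suc j) (0, 1))))"
    by (rule sum.reindex_bij_witness[of _ Suc "\<lambda>j. j - 1"]) auto
  also have "\<dots> = (\<Sum>j<n. zmul (inv_factorial (Suc j)) ((m a ^^ j) a))"
    by (simp only: id_mult_pow_one[of m a, OF mult_right.zero] fst_conv)
  also have "\<dots> = phi 1 (m a) a"
    unfolding phi_def by (rule sum.mono_neutral_cong) (auto simp: funpow_mult_eq_zero_n funpow_mult_eq_zero_k)
  finally show ?thesis unfolding W_def .
qed

lemma group_of_flows_W: "group_of_flows p n m (W x) b = W x + E x b"
proof -
  have "flowW p n m = W" using flowW_eq_W by blast
  moreover have "inj W" using bij_betw_W F_0 by (simp add: bij_betw_def)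
  ultimately have "flowOmega p n m (W x) = x"
    by (simp add: flowOmega_def)
  then show ?thesis by (simp add: group_of_flows_def fst_expL)
qed

lemma obtain_W:
  obtains x where "W x = a"
  using bij_betw_W F_0 by (metis UNIV_I bij_betw_def imageE)

lemma brace_star_group_of_flows_W: "brace_star (group_of_flows p n m) (W x) b = E x b - b"
  by (simp add: brace_star_def group_of_flows_W)

lemma brace_star_group_of_flows_F:
  assumes "a \<in> F i" "b \<in> F j"
  shows "brace_star (group_of_flows p n m) a b \<in> F (i + j)"
proof -
  obtain x where x: "W x = a" by (rule obtain_W)
  then have "x \<in> F i" using W_F_iff[of x i] assms F_0 by simp
  then show ?thesis using E_diff_self_F[OF _ assms(2)] x brace_star_group_of_flows_W by metis
qed

lemma strong_series_group_of_flows: "strong_series (brace_star (group_of_flows p n m)) i \<subseteq> F i"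
  by (rule strong_series_subset_F[OF F_0 brace_star_group_of_flows_F])

end

lemma is_group_opI:
  assumes assoc: "\<And>a b d. c (c a b) d = c a (c b d)" and left: "\<And>a. c e a = a" and right: "\<And>a. c a e = a"
    and inv: "\<And>a. \<exists>b. c a b = e"
  shows "is_group_op c"
proof -
  have "\<exists>b. c a b = e \<and> c b a = e" for a
  proof -
    obtain b where b: "c a b = e" using inv by blast
    obtain d where d: "c b d = e" using inv by blast
    have "a = d" using assoc[of a b d] by (simp add: b d left right)
    then show ?thesis using b d by blast
  qed
  then show ?thesis unfolding is_group_op_def using assoc left right by blast
qed

locale finite_filtered_prelie =
  finite_filtered_algebra k F p n m + filtered_prelie k F p n m
  for k and F :: "nat \<Rightarrow> 'a::{ab_group_add, finite} set" and p n m
begin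

lemma group_of_flows_assoc:
  "group_of_flows p n m (group_of_flows p n m a b) d = group_of_flows p n m a (group_of_flows p n m b d)"
proof -
  let ?c = "group_of_flows p n m"
  obtain x where x: "W x = a" by (rule obtain_W)
  obtain y where y: "W y = b" by (rule obtain_W)
  have xy: "W (bch x y) = W x + E x (W y)" by (rule W_bch) (simp_all add: F_0)
  have "?c (?c a b) d = W (bch x y) + E (bch x y) d"
    using group_of_flows_W[of x b] group_of_flows_W[of "bch x y" d] by (simp add: x y xy)
  also have "\<dots> = W x + E x (W y + E y d)"
    by (simp add: E_bch F_0 xy E.add)
  also have "\<dots> = ?c a (?c b d)"
    using group_of_flows_W[of x] group_of_flows_W[of y d] by (simp add: x y)
  finally show ?thesis .
qed

lemma is_group_op_group_of_flows: "is_group_op (group_of_flows p n m)"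
proof (rule is_group_opI[OF group_of_flows_assoc])
  fix a
  obtain x where x: "W x = a" by (rule obtain_W)
  show "group_of_flows p n m 0 a = a" using group_of_flows_W[of 0 a] by simp
  show "group_of_flows p n m a 0 = a" using group_of_flows_W[of x 0] x by (simp add: E.zero)
  have "bij (E x)"
    using near_identity_bij_betw[OF near_identity_phi_0[OF filtered_hom_mult_F_0]] F_0 by simp
  then obtain b where "E x b = - a" by (metis bij_pointE)
  then show "\<exists>b. group_of_flows p n m a b = 0" using group_of_flows_W[of x b] x by auto
qed

lemma is_brace_group_of_flows: "is_brace (group_of_flows p n m)"
  unfolding is_brace_def
proof (intro conjI allI is_group_op_group_of_flows)
  fix a b d
  obtain x where "W x = a" by (rule obtain_W)
  then show "group_of_flows p n m a (b + d) + a = group_of_flows p n m a b + group_of_flows p n m a d"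
    using group_of_flows_W[of x] by (simp add: E.add algebra_simps)
qed

end

lemma brace_star_add_right:
  assumes "is_brace c"
  shows "brace_star c a (b + d) = brace_star c a b + brace_star c a d"
proof -
  have "c a (b + d) + a = c a b + c a d" using assms by (simp add: is_brace_def)
  then show ?thesis by (simp add: brace_star_def algebra_simps)
qed

lemma brace_star_circ_left:
  assumes "is_brace c"
  shows "brace_star c (a + b + brace_star c a b) d =
    brace_star c a (brace_star c b d) + brace_star c a d + brace_star c b d"
proof -
  have c: "c x y = x + y + brace_star c x y" for x y by (simp add: brace_star_def)
  have "c (c a b) d = c a (c b d)" using assms by (simp add: is_brace_def is_group_op_def)
  then have "c a b + d + brace_star c (c a b) d = a + c b d + brace_star c a (c b d)"
    by (simp only: c[of "c a b", symmetric] c[of a "c b d", symmetric])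
  then show ?thesis
    unfolding c[of a b] c[of b d]
    by (simp add: brace_star_add_right[OF assms] algebra_simps)
qed

section \<open>The correspondence\<close>

lemma (in filtered_brace) assoc_prelie_eq_dot:
  assumes "star = brace_star c"
  shows "assoc_prelie p n \<gamma> c = dot"
proof (intro ext)
  fix a b
  have "{0..p - 2} = {..<p - 1}" using one_less by auto
  then show "assoc_prelie p n \<gamma> c a b = dot a b"
    by (simp add: assoc_prelie_def assoc_dot_def dot_def coef_def assms[symmetric] Let_def)
qed

lemma (in filtered_brace) strong_series_dot: "strong_series dot i \<subseteq> F i"
  by (rule strong_series_subset_F[OF F_0 F_dot])

lemma filtered_brace_strong_series:
  fixes c :: "'a::{ab_group_add, finite} \<Rightarrow> 'a \<Rightarrow> 'a"
  assumes "prime p" "k < p" "2 \<le> k" "n \<le> p" "card (UNIV :: 'a set) = p ^ n"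
    "residue_primroot (p ^ p) \<gamma>" "is_brace c" "strong_series (brace_star c) k \<subseteq> {0}"
  shows "filtered_brace k (strong_series (brace_star c)) p n \<gamma> (brace_star c)"
proof -
  interpret torsion_filtration k "strong_series (brace_star c)" p n
    using assms by (intro torsion_filtration_strong_series)
  show ?thesis
    by unfold_locales
      (use assms in \<open>auto simp: strong_series_le_1 brace_star_add_right brace_star_circ_left
        intro: strong_series_mult\<close>)
qed

lemma finite_filtered_prelie_strong_series:
  fixes m :: "'a::{ab_group_add, finite} \<Rightarrow> 'a \<Rightarrow> 'a"
  assumes "prime p" "k < p" "2 \<le> k" "card (UNIV :: 'a set) = p ^ n"
    "is_prelie m" "strong_series m k \<subseteq> {0}"
  shows "finite_filtered_prelie k (strong_series m) p n m"
proof -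
  interpret torsion_filtration k "strong_series m" p n
    using assms by (intro torsion_filtration_strong_series)
  show ?thesis
    by unfold_locales
      (use assms in \<open>auto simp: strong_series_le_1 is_prelie_def intro: strong_series_mult\<close>)
qed

lemma
  fixes c :: "'a::{ab_group_add, finite} \<Rightarrow> 'a \<Rightarrow> 'a"
  assumes p: "prime p" "k < p" "n \<le> p" "card (UNIV :: 'a set) = p ^ n" "residue_primroot (p ^ p) \<gamma>"
    and c: "c \<in> brace_structures k"
  shows assoc_prelie_in_prelie_structures: "assoc_prelie p n \<gamma> c \<in> prelie_structures k"
    and group_of_flows_assoc_prelie: "group_of_flows p n (assoc_prelie p n \<gamma> c) = c"
proof -
  let ?S = "strong_series (brace_star c)"
  have brace: "is_brace c" and index: "nilpotency_index (brace_star c) k"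
    using c by (auto simp: brace_structures_def)
  have "2 \<le> k" using index by (rule nilpotency_index_ge_2)
  have S_k: "?S k \<subseteq> {0}" using index by (simp add: nilpotency_index_def)
  interpret filtered_brace k ?S p n \<gamma> "brace_star c"
    by (rule filtered_brace_strong_series) (use p brace \<open>2 \<le> k\<close> S_k in auto)
  have assoc_prelie: "assoc_prelie p n \<gamma> c = dot" by (rule assoc_prelie_eq_dot) simp
  have prelie: "is_prelie dot"
    using dot_add_left dot_add_right dot_prelie by (auto simp: is_prelie_def)
  interpret dot: finite_filtered_algebra k ?S p n dot
    by unfold_locales (use p F_0 in auto)
  show flows: "group_of_flows p n (assoc_prelie p n \<gamma> c) = c"
  proof (intro ext)
    fix a b
    obtain x where "dot.W x = a" "dot.E x b = b + brace_star c a b" using circ_log[of a] by metis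
    then show "group_of_flows p n (assoc_prelie p n \<gamma> c) a b = c a b"
      using dot.group_of_flows_W[of x b] by (simp add: assoc_prelie brace_star_def algebra_simps)
  qed
  interpret series: finite_filtered_prelie k "strong_series dot" p n dot
    by (rule finite_filtered_prelie_strong_series) (use p \<open>2 \<le> k\<close> prelie S_k strong_series_dot[of k] in auto)
  have "strong_series dot i = ?S i" for i
    using strong_series_dot series.strong_series_group_of_flows[of i] flows by (auto simp: assoc_prelie)
  then show "assoc_prelie p n \<gamma> c \<in> prelie_structures k"
    using prelie index by (simp add: prelie_structures_def assoc_prelie nilpotency_index_def)
qed

context finite_filtered_prelie
begin

lemma filtered_brace_group_of_flows:
  assumes "n \<le> p" "residue_primroot (p ^ p) \<gamma>"
  shows "filtered_brace k F p n \<gamma> (brace_star (group_of_flows p n m))"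
  by unfold_locales
    (use assms in \<open>auto simp: F_0 brace_star_add_right[OF is_brace_group_of_flows]
      brace_star_circ_left[OF is_brace_group_of_flows] intro: brace_star_group_of_flows_F\<close>)

lemma assoc_prelie_group_of_flows_eq:
  assumes "n \<le> p" "residue_primroot (p ^ p) \<gamma>"
  shows "assoc_prelie p n \<gamma> (group_of_flows p n m) = m"
proof (intro ext)
  let ?star = "brace_star (group_of_flows p n m)"
  interpret brace: filtered_brace k F p n \<gamma> ?star
    using assms by (rule filtered_brace_group_of_flows)
  fix x b
  obtain c where c: "\<And>j. c j \<in> F j" "c 0 = 0" "c (Suc 0) = x" and W: "\<And>t. W (zmul (int t) x) = eval_poly c t"
    using W_zmul_eq_eval_poly[of x] F_0 by auto
  have "brace.dot x b = brace.deriv_at_0 (\<lambda>t. ?star (eval_poly c t) b)"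
    using brace.deriv_at_0_star_const[OF polymap_eval_poly, of c b] brace.coef_eval_poly[of "Suc 0" c] c k_ge_2
    by (simp add: eval_poly_0)
  also have "\<dots> = brace.deriv_at_0 (\<lambda>t. E (zmul (int t) x) b + - b)"
    by (simp add: W[symmetric] brace_star_group_of_flows_W)
  also have "\<dots> = m x b"
    unfolding brace.coef_add brace.deriv_at_0_const E_zmul_eq_eval_poly
    using brace.coef_eval_poly[of "Suc 0"] k_ge_2 by simp
  finally show "assoc_prelie p n \<gamma> (group_of_flows p n m) x b = m x b"
    by (simp add: brace.assoc_prelie_eq_dot)
qed

end

lemma
  fixes m :: "'a::{ab_group_add, finite} \<Rightarrow> 'a \<Rightarrow> 'a"
  assumes p: "prime p" "k < p" "n \<le> p" "card (UNIV :: 'a set) = p ^ n" "residue_primroot (p ^ p) \<gamma>"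
    and m: "m \<in> prelie_structures k"
  shows group_of_flows_in_brace_structures: "group_of_flows p n m \<in> brace_structures k"
    and assoc_prelie_group_of_flows: "assoc_prelie p n \<gamma> (group_of_flows p n m) = m"
proof -
  let ?c = "group_of_flows p n m"
  have prelie: "is_prelie m" and index: "nilpotency_index m k"
    using m by (auto simp: prelie_structures_def)
  have "2 \<le> k" using index by (rule nilpotency_index_ge_2)
  have S_k: "strong_series m k \<subseteq> {0}" using index by (simp add: nilpotency_index_def)
  interpret finite_filtered_prelie k "strong_series m" p n m
    by (rule finite_filtered_prelie_strong_series) (use p \<open>2 \<le> k\<close> prelie S_k in auto)
  show assoc_prelie: "assoc_prelie p n \<gamma> ?c = m"
    using p by (intro assoc_prelie_group_of_flows_eq)
  interpret series: filtered_brace k "strong_series (brace_star ?c)" p n \<gamma> "brace_star ?c"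
    by (rule filtered_brace_strong_series)
      (use p is_brace_group_of_flows \<open>2 \<le> k\<close> S_k strong_series_group_of_flows[of k] in auto)
  have "strong_series (brace_star ?c) i = strong_series m i" for i
    using strong_series_group_of_flows series.strong_series_dot[of i] series.assoc_prelie_eq_dot[of ?c]
      assoc_prelie by auto
  then show "?c \<in> brace_structures k"
    using is_brace_group_of_flows index by (simp add: brace_structures_def nilpotency_index_def)
qed

theorem theorem1:
  fixes p n k \<gamma> :: nat
  assumes "prime p" and "k + 1 \<le> p" and "n + 2 \<le> p"
    and "card (UNIV :: 'a::{ab_group_add, finite} set) = p ^ n"
    and "residue_primroot (p ^ p) \<gamma>"
  shows "bij_betw (group_of_flows p n)
           (prelie_structures k :: ('a \<Rightarrow> 'a \<Rightarrow> 'a) set) (brace_structures k)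
       \<and> (\<forall>c \<in> (brace_structures k :: ('a \<Rightarrow> 'a \<Rightarrow> 'a) set).
            inv_into (prelie_structures k) (group_of_flows p n) c = assoc_prelie p n \<gamma> c)
       \<and> card (prelie_structures k :: ('a \<Rightarrow> 'a \<Rightarrow> 'a) set) = card (brace_structures k :: ('a \<Rightarrow> 'a \<Rightarrow> 'a) set)"
proof (intro conjI ballI)
  have p: "prime p" "k < p" "n \<le> p" using assms by auto
  note of_brace = assoc_prelie_in_prelie_structures[OF p assms(4,5)]
    group_of_flows_assoc_prelie[OF p assms(4,5)]
  note of_prelie = group_of_flows_in_brace_structures[OF p assms(4,5)]
    assoc_prelie_group_of_flows[OF p assms(4,5)]
  show bij: "bij_betw (group_of_flows p n) (prelie_structures k :: ('a \<Rightarrow> 'a \<Rightarrow> 'a) set) (brace_structures k)"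
    by (rule bij_betw_byWitness[where f' = "assoc_prelie p n \<gamma>"]) (use of_brace of_prelie in auto)
  show "inv_into (prelie_structures k) (group_of_flows p n) c = assoc_prelie p n \<gamma> c"
    if "c \<in> brace_structures k" for c :: "'a \<Rightarrow> 'a \<Rightarrow> 'a"
    by (rule inv_into_f_eq) (use bij of_brace[OF that] in \<open>auto simp: bij_betw_def\<close>)
  show "card (prelie_structures k :: ('a \<Rightarrow> 'a \<Rightarrow> 'a) set) = card (brace_structures k :: ('a \<Rightarrow> 'a \<Rightarrow> 'a) set)"
    using bij by (rule bij_betw_same_card)
qed

end
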